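(* There exists an absolute constant $c>0$ such that for every $n\geq 2$ there exists an unconditional convex body $K_0$ of volume $1$ in $\mathbb{R}^n$ which has minimal surface area and satisfies $$|K_0|^{\frac{1}{n}}\,\min_{\xi\in S^{n-1}}S(P_{\xi^{\perp}}(K_0))\leq \frac{c}{\sqrt{n}}\,S(K_0).$$
   Context: A convex body in $\mathbb{R}^n$ is a compact convex set with non-empty interior. It is unconditional if it is invariant under reflections in the coordinate hyperplanes (of the standard orthonormal basis). $|\cdot|$ denotes volume, $S^{n-1}$ is the Euclidean unit sphere, and $P_{\xi^{\perp}}$ is the orthogonal projection onto the hyperplane $\xi^{\perp}$. $S(A)$ is the surface area of a convex body $A$; $P_{\xi^\perp}(K_0)$ is regarded as a convex body in the $(n-1)$-dimensional Euclidean space $\xi^\perp$, and its surface area is taken there. In dimension $m$ one has $S(A)=mV((A,m-1),(B_2^m,1))$ (a mixed volume, $B_2^m$ the Euclidean unit ball); in particular the surface area of a segment in a one-dimensional space is $2$. A convex body $K$ has minimal surface area if $S(K)\leq S(T(K))$ for every $T\in SL(n)$. "Absolute constant" means a constant independent of $n$. *)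

theory Defs
  imports
    "HOL-Analysis.Analysis"
    "HOL-Library.Function_Algebras"
    "Jordan_Normal_Form.Determinant"
begin

text \<open>
  The dimension is quantified inside the scope of an absolute constant, so it cannot be a type.
  Euclidean \<open>n\<close>-space is the library's \<^const>\<open>Euclidean_space\<close> \<open>n\<close>: functions \<open>nat \<Rightarrow> real\<close> that vanish
  from \<open>n\<close> on. The pointwise vector space structure makes \<^const>\<open>convex\<close> and \<open>*\<^sub>R\<close> applicable.
\<close>

instantiation "fun" :: (type, real_vector) real_vector
begin

definition scaleR_fun_def: "r *\<^sub>R f = (\<lambda>x. r *\<^sub>R f x)"

instance
  by standard (auto simp: scaleR_fun_def fun_eq_iff scaleR_add_right scaleR_add_left)

end

abbreviation eucl :: "nat \<Rightarrow> (nat \<Rightarrow> real) set" where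
  "eucl n \<equiv> topspace (Euclidean_space n)"

definition dot :: "nat \<Rightarrow> (nat \<Rightarrow> real) \<Rightarrow> (nat \<Rightarrow> real) \<Rightarrow> real" where
  "dot n x y = (\<Sum>i<n. x i * y i)"

definition unit_ball :: "nat \<Rightarrow> (nat \<Rightarrow> real) set" where
  "unit_ball n = {x \<in> eucl n. L2_set x {..<n} \<le> 1}"

definition unit_sphere :: "nat \<Rightarrow> (nat \<Rightarrow> real) set" where
  "unit_sphere n = {x \<in> eucl n. L2_set x {..<n} = 1}"

text \<open>Points of \<^const>\<open>PiM\<close> are \<open>undefined\<close>, rather than \<open>0\<close>, outside the index set.\<close>

definition vol :: "nat \<Rightarrow> (nat \<Rightarrow> real) set \<Rightarrow> real" where
  "vol n A = measure (PiM {..<n} (\<lambda>_. lborel)) ((\<lambda>x. restrict x {..<n}) ` A)"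

definition convex_body :: "nat \<Rightarrow> (nat \<Rightarrow> real) set \<Rightarrow> bool" where
  "convex_body n K \<longleftrightarrow>
     compactin (Euclidean_space n) K \<and> convex K \<and> Euclidean_space n interior_of K \<noteq> {}"

definition unconditional :: "nat \<Rightarrow> (nat \<Rightarrow> real) set \<Rightarrow> bool" where
  "unconditional n K \<longleftrightarrow> (\<forall>i<n. (\<lambda>x. x(i := - x i)) ` K = K)"

text \<open>
  Surface area as Minkowski content with respect to the Euclidean ball \<open>B\<close>. For a convex body \<open>A\<close>,
  \<open>|A + \<epsilon> B|\<close> is a polynomial in \<open>\<epsilon>\<close> whose linear coefficient is \<open>m V((A, m - 1), (B, 1))\<close>; hence the
  quotient converges and the lower limit is this finite limit. In dimension 1 a segment has
  surface area 2.
\<close>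

definition surface_area :: "nat \<Rightarrow> (nat \<Rightarrow> real) set \<Rightarrow> ereal" where
  "surface_area m A = Liminf (at_right 0)
     (\<lambda>\<epsilon>. ereal ((vol m {x + \<epsilon> *\<^sub>R y | x y. x \<in> A \<and> y \<in> unit_ball m} - vol m A) / \<epsilon>))"

definition mat_image :: "real mat \<Rightarrow> (nat \<Rightarrow> real) set \<Rightarrow> (nat \<Rightarrow> real) set" where
  "mat_image T A =
     (\<lambda>x i. if i < dim_row T then \<Sum>j<dim_col T. T $$ (i, j) * x j else 0) ` A"

definition minimal_surface_area :: "nat \<Rightarrow> (nat \<Rightarrow> real) set \<Rightarrow> bool" where
  "minimal_surface_area n K \<longleftrightarrow>
     (\<forall>T \<in> carrier_mat n n. Determinant.det T = 1 \<longrightarrow>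
        surface_area n K \<le> surface_area n (mat_image T K))"

definition proj_perp :: "nat \<Rightarrow> (nat \<Rightarrow> real) \<Rightarrow> (nat \<Rightarrow> real) \<Rightarrow> (nat \<Rightarrow> real)" where
  "proj_perp n \<xi> x = x - dot n x \<xi> *\<^sub>R \<xi>"

definition orthonormal_basis_perp :: "nat \<Rightarrow> (nat \<Rightarrow> real) \<Rightarrow> (nat \<Rightarrow> nat \<Rightarrow> real) \<Rightarrow> bool" where
  "orthonormal_basis_perp n \<xi> b \<longleftrightarrow>
     (\<forall>i<n - 1. b i \<in> eucl n \<and> dot n (b i) \<xi> = 0) \<and>
     (\<forall>i<n - 1. \<forall>j<n - 1. dot n (b i) (b j) = (if i = j then 1 else 0))"

text \<open>
  The surface area of a subset of the hyperplane orthogonal to the unit vector \<open>\<xi>\<close>, taken inside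
  that hyperplane, which is identified with Euclidean \<open>(n - 1)\<close>-space through the coordinates of an
  orthonormal basis. The value does not depend on the basis, by orthogonal invariance of volume.
\<close>

definition surface_area_perp :: "nat \<Rightarrow> (nat \<Rightarrow> real) \<Rightarrow> (nat \<Rightarrow> real) set \<Rightarrow> ereal" where
  "surface_area_perp n \<xi> A =
     (let b = (SOME b. orthonormal_basis_perp n \<xi> b)
      in surface_area (n - 1) ((\<lambda>x i. if i < n - 1 then dot n x (b i) else 0) ` A))"

end

theory Submission
  imports Defs
begin

text \<open>
  The body is the cylinder \<open>K = r B\<^sup>m \<times> [-r, r]\<close> with \<open>m = n - 1\<close> and \<open>2 r |r B\<^sup>m| = 1\<close>. It is circumscribed
  about \<open>r B\<^sup>n\<close>, so \<open>K + \<epsilon> B \<subseteq> (1 + \<epsilon>/r) K\<close> and \<open>S(K) \<le> n/r\<close>.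

  For \<open>det T = 1\<close> write \<open>T = Q R\<close> with \<open>Q\<close> orthogonal and \<open>R\<close> upper triangular with positive diagonal.
  Then \<open>|T K + \<epsilon> B| = |R K + \<epsilon> B|\<close>, and slicing orthogonally to the axis gives the lower bound
  \<open>1 + (\<epsilon>/r) \<Sum>1/R\<^sub>i\<^sub>i\<close>, which by the inequality of the means is at least \<open>1 + n \<epsilon>/r\<close>. Hence
  \<open>S(T K) \<ge> n/r = S(K)\<close>.

  Every projection of \<open>K\<close> contains a ball of radius \<open>r\<close>, and the projection along the axis is such a ball.
  The surface area of a compact set that contains a ball centred at the origin is at least that of the
  ball (compare the parallel shells along rays), so the axis is a minimizing direction, with value
  \<open>m |B\<^sup>m| r\<^sup>m\<^sup>-\<^sup>1 = m / (2 r\<^sup>2)\<close>. The claim then reduces to \<open>r \<ge> \<surd>n / 8\<close>, a bound on the volume of the ball.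
\<close>

section \<open>Lebesgue measure on Euclidean space\<close>

text \<open>Why this body: for minimality each coordinate direction should carry the same share of
  the surface. At volume 1 the two bases have total area \<open>1/r\<close> and the lateral part has
  area \<open>m/r\<close>, that is, \<open>1/r\<close> per coordinate; this forces half height and
  radius to agree. A triangular map changes the i-th share to \<open>1/(r R i i)\<close> in the
  lower bound, so the product being 1 makes equal shares optimal. The gain in the projection comes
  from the base: the height \<open>2 r\<close> is of order \<open>sqrt n\<close>, so volume 1 leaves
  the base only the volume \<open>1/(2 r)\<close>. For the ball or the cube the same quotient stays
  of constant order.

  Surface area is a lower limit, so each comparison is made between volumes of parallel bodies at a
  fixed \<open>e > 0\<close> and then passes to the limit by monotonicity. This replaces Steiner's
  formula and mixed volumes. As the dimension is a variable, substitution under triangular maps,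
  invariance under orthogonal maps and integration along rays are derived directly from the product
  measure.\<close>

abbreviation extend0 :: "nat \<Rightarrow> (nat \<Rightarrow> real) \<Rightarrow> nat \<Rightarrow> real" where
  "extend0 n x \<equiv> (\<lambda>i. if i < n then x i else 0)"

text \<open>Lebesgue measure of dimension \<open>n\<close> as a measure on the Borel sets of all
  sequences, concentrated on \<open>eucl n\<close>. All dimensions thus share one sigma-algebra, and
  measurability of a map on sequences can be checked once for every \<open>n\<close>.\<close>

definition eucl_lborel :: "nat \<Rightarrow> (nat \<Rightarrow> real) measure" where
  "eucl_lborel n = distr (PiM {..<n} (\<lambda>_. lborel)) borel (extend0 n)"

lemma space_eucl_lborel [simp]: "space (eucl_lborel n) = UNIV" by (simp add: eucl_lborel_def)

lemma sets_eucl_lborel [simp, measurable_cong]: "sets (eucl_lborel n) = sets borel"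
  by (simp add: eucl_lborel_def)

lemma measurable_eucl_lborel [simp]: "measurable (eucl_lborel n) N = measurable borel N"
  by (rule measurable_cong_sets) simp_all

lemma measurable_to_eucl_lborel [simp]: "measurable M (eucl_lborel n) = measurable M borel"
  by (rule measurable_cong_sets) simp_all

lemma in_eucl_iff: "x \<in> eucl n \<longleftrightarrow> (\<forall>i\<ge>n. x i = 0)"
  by (simp add: topspace_Euclidean_space)

lemma borel_measurable_coordinatewise_iff:
  fixes f :: "'a \<Rightarrow> nat \<Rightarrow> real"
  shows "f \<in> borel_measurable M \<longleftrightarrow> (\<forall>i. (\<lambda>x. f x i) \<in> borel_measurable M)"
proof
  assume "f \<in> borel_measurable M"
  then show "\<forall>i. (\<lambda>x. f x i) \<in> borel_measurable M"
    by (intro allI) (rule measurable_product_then_coordinatewise)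
next
  assume "\<forall>i. (\<lambda>x. f x i) \<in> borel_measurable M"
  then have "\<And>i. (\<lambda>x. f x i) \<in> borel_measurable M" by (rule spec)
  then show "f \<in> borel_measurable M" by (rule measurable_coordinatewise_then_product)
qed

lemma continuous_on_coord: "continuous_on S (\<lambda>x :: nat \<Rightarrow> real. x i)"
  by (rule continuous_on_subset[OF continuous_on_product_coordinates subset_UNIV])

lemma continuous_on_L2_set: "continuous_on S (\<lambda>x :: nat \<Rightarrow> real. L2_set x {..<n})"
  unfolding L2_set_def by (intro continuous_on_real_sqrt continuous_on_sum continuous_on_power continuous_on_coord)

lemma borel_measurable_L2_set [measurable]:
  "(\<lambda>x. L2_set x {..<n}) \<in> borel_measurable (borel :: (nat \<Rightarrow> real) measure)"
  by (intro borel_measurable_continuous_onI continuous_on_L2_set)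

lemma measurable_extend0_PiM [measurable]:
  assumes "k \<le> n" shows "extend0 k \<in> borel_measurable (PiM {..<n} (\<lambda>_. lborel))"
  unfolding borel_measurable_coordinatewise_iff
proof
  fix i show "(\<lambda>x. extend0 k x i) \<in> borel_measurable (PiM {..<n} (\<lambda>_. lborel))"
  proof (cases "i < k")
    case True
    with assms have "(\<lambda>x. x i) \<in> measurable (PiM {..<n} (\<lambda>_. lborel :: real measure)) lborel"
      by (intro measurable_component_singleton) auto
    with True show ?thesis by simp
  qed simp
qed

lemma vol_eq_eucl_lborel:
  assumes "A \<subseteq> eucl n" "A \<in> sets borel"
  shows "vol n A = measure (eucl_lborel n) A"
proof -
  have "(\<lambda>x. restrict x {..<n}) ` A = extend0 n -` A \<inter> space (PiM {..<n} (\<lambda>_. lborel :: real measure))"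
    (is "?L = ?R")
  proof
    show "?L \<subseteq> ?R"
    proof
      fix y assume "y \<in> ?L"
      then obtain x where x: "x \<in> A" "y = restrict x {..<n}" by blast
      then have "extend0 n y = x" using assms(1) by (force simp: in_eucl_iff)
      with x(1) have "extend0 n y \<in> A" by simp
      moreover have "y \<in> space (PiM {..<n} (\<lambda>_. lborel :: real measure))"
        unfolding x(2) by (simp add: space_PiM)
      ultimately show "y \<in> ?R" by blast
    qed
    show "?R \<subseteq> ?L"
    proof
      fix x assume x: "x \<in> ?R"
      then have "x = restrict (extend0 n x) {..<n}"
        by (auto simp: space_PiM PiE_def extensional_def)
      with x show "x \<in> ?L" by blast
    qed
  qed
  then show ?thesis
    unfolding vol_def eucl_lborel_def using assms(2) by (simp add: measure_distr)
qed

lemma AE_eucl_lborel_eucl: "AE x in eucl_lborel n. x \<in> eucl n"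
proof -
  have "closed (eucl n)" by (rule closedin_Euclidean_imp_closed) (rule closedin_topspace)
  then have *: "{x \<in> space borel. x \<in> eucl n} \<in> sets borel" by simp
  show ?thesis
    unfolding eucl_lborel_def AE_distr_iff[OF measurable_extend0_PiM[OF order_refl] *]
    by (rule AE_I2) (simp add: in_eucl_iff)
qed

lemma nn_integral_eucl_lborel:
  assumes "f \<in> borel_measurable borel"
  shows "(\<integral>\<^sup>+x. f x \<partial>eucl_lborel n) = (\<integral>\<^sup>+x. f (extend0 n x) \<partial>PiM {..<n} (\<lambda>_. lborel))"
  unfolding eucl_lborel_def by (rule nn_integral_distr[OF measurable_extend0_PiM[OF order_refl]]) (simp add: assms)

lemma measurable_fun_upd_real:
  fixes f :: "'a \<Rightarrow> nat \<Rightarrow> real"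
  assumes [measurable]: "f \<in> borel_measurable M" "g \<in> borel_measurable M"
  shows "(\<lambda>x. (f x)(k := g x)) \<in> borel_measurable M"
  unfolding borel_measurable_coordinatewise_iff
proof
  fix i :: nat
  have "(\<lambda>x. f x i) \<in> borel_measurable M"
    by (rule measurable_product_then_coordinatewise) (rule assms(1))
  then show "(\<lambda>x. ((f x)(k := g x)) i) \<in> borel_measurable M"
    by (cases "i = k") auto
qed

text \<open>An arbitrary coordinate becomes the innermost variable, which prepares one-dimensional
  substitutions in that coordinate alone.\<close>

lemma nn_integral_eucl_lborel_coord:
  fixes f :: "(nat \<Rightarrow> real) \<Rightarrow> ennreal"
  assumes [measurable]: "f \<in> borel_measurable borel" and "k < n"
  shows "(\<integral>\<^sup>+x. f x \<partial>eucl_lborel n) =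
    (\<integral>\<^sup>+x. \<integral>\<^sup>+y. f ((extend0 n x)(k := y)) \<partial>lborel \<partial>PiM ({..<n} - {k}) (\<lambda>_. lborel))"
proof -
  interpret product_sigma_finite "\<lambda>_. lborel :: real measure" by standard
  have ins: "{..<n} = insert k ({..<n} - {k})" using assms by auto
  have "(\<integral>\<^sup>+x. f x \<partial>eucl_lborel n) = (\<integral>\<^sup>+x. f (extend0 n x) \<partial>PiM (insert k ({..<n} - {k})) (\<lambda>_. lborel))"
    by (subst nn_integral_eucl_lborel) (use ins in auto)
  also have "\<dots> = (\<integral>\<^sup>+x. \<integral>\<^sup>+y. f (extend0 n (x(k := y))) \<partial>lborel \<partial>PiM ({..<n} - {k}) (\<lambda>_. lborel))"
    by (subst product_nn_integral_insert) (use ins assms(1) in auto)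
  also have "(\<lambda>x y. extend0 n (x(k := y))) = (\<lambda>x y. (extend0 n x)(k := y))"
    using \<open>k < n\<close> by (auto simp: fun_eq_iff)
  finally show ?thesis .
qed

text \<open>Here the last coordinate is the outer variable, so that the inner integral runs over a
  slice and is again taken with respect to \<open>eucl_lborel\<close>, one dimension lower.\<close>

lemma nn_integral_eucl_lborel_Suc:
  fixes f :: "(nat \<Rightarrow> real) \<Rightarrow> ennreal"
  assumes [measurable]: "f \<in> borel_measurable borel"
  shows "(\<integral>\<^sup>+x. f x \<partial>eucl_lborel (Suc m)) = (\<integral>\<^sup>+t. \<integral>\<^sup>+x. f (x(m := t)) \<partial>eucl_lborel m \<partial>lborel)"
proof -
  interpret product_sigma_finite "\<lambda>_. lborel :: real measure" by standard
  have ins: "{..<Suc m} = insert m {..<m}" by auto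
  have "(\<integral>\<^sup>+x. f x \<partial>eucl_lborel (Suc m)) = (\<integral>\<^sup>+x. f (extend0 (Suc m) x) \<partial>PiM (insert m {..<m}) (\<lambda>_. lborel))"
    by (simp add: nn_integral_eucl_lborel flip: ins)
  also have "\<dots> = (\<integral>\<^sup>+t. \<integral>\<^sup>+x. f (extend0 (Suc m) (x(m := t))) \<partial>PiM {..<m} (\<lambda>_. lborel) \<partial>lborel)"
    by (rule product_nn_integral_insert_rev) (simp_all flip: ins)
  also have "\<dots> = (\<integral>\<^sup>+t. \<integral>\<^sup>+x. f ((extend0 m x)(m := t)) \<partial>PiM {..<m} (\<lambda>_. lborel) \<partial>lborel)"
    by (intro nn_integral_cong arg_cong[where f = f]) (simp add: fun_eq_iff)
  also have "\<dots> = (\<integral>\<^sup>+t. \<integral>\<^sup>+x. f (x(m := t)) \<partial>eucl_lborel m \<partial>lborel)"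
    by (subst nn_integral_eucl_lborel)
      (intro measurable_compose[OF _ assms] measurable_fun_upd_real measurable_ident_sets measurable_const, simp_all)
  finally show ?thesis .
qed

lemma emeasure_eucl_lborel_ball:
  assumes "r > 0"
  shows "emeasure (eucl_lborel n) {x. L2_set x {..<n} \<le> r} = ennreal (unit_ball_vol (real n) * r ^ n)"
proof -
  have "emeasure (eucl_lborel n) {x. L2_set x {..<n} \<le> r} =
      emeasure (PiM {..<n} (\<lambda>_. lborel))
        ({f. sqrt (\<Sum>i<n. (f i)\<^sup>2) \<le> r} \<inter> space (PiM {..<n} (\<lambda>_. lborel)))"
    unfolding eucl_lborel_def
  proof (subst emeasure_distr)
    show "{x. L2_set x {..<n} \<le> r} \<in> sets borel"
      by (intro borel_closed closed_Collect_le continuous_on_L2_set continuous_on_const)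
    have "L2_set (extend0 n f) {..<n} = sqrt (\<Sum>i<n. (f i)\<^sup>2)" for f :: "nat \<Rightarrow> real"
      unfolding L2_set_def by (intro arg_cong[where f = sqrt] sum.cong) simp_all
    then show "emeasure (PiM {..<n} (\<lambda>_. lborel))
        (extend0 n -` {x. L2_set x {..<n} \<le> r} \<inter> space (PiM {..<n} (\<lambda>_. lborel))) =
      emeasure (PiM {..<n} (\<lambda>_. lborel))
        ({f. sqrt (\<Sum>i<n. (f i)\<^sup>2) \<le> r} \<inter> space (PiM {..<n} (\<lambda>_. lborel)))"
      unfolding vimage_def by simp
  qed (rule measurable_extend0_PiM[OF order_refl])
  also have "\<dots> = ennreal (unit_ball_vol (real n) * r ^ n)"
    using emeasure_cball_aux[of "{..<n}" r] assms by simp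
  finally show ?thesis .
qed

lemma sigma_finite_eucl_lborel: "sigma_finite_measure (eucl_lborel n)"
proof
  define B where "B k = {x :: nat \<Rightarrow> real. L2_set x {..<n} \<le> real (Suc k)}" for k :: nat
  have "x \<in> (\<Union>k. B k)" for x
  proof -
    obtain k :: nat where "L2_set x {..<n} \<le> real k" using real_arch_simple by blast
    then have "x \<in> B k" unfolding B_def by simp
    then show ?thesis by blast
  qed
  then have "\<Union>(range B) = space (eucl_lborel n)" unfolding space_eucl_lborel by blast
  moreover have "B k \<in> sets (eucl_lborel n)" for k
    unfolding B_def sets_eucl_lborel
    by (intro borel_closed closed_Collect_le continuous_on_L2_set continuous_on_const)
  moreover have "emeasure (eucl_lborel n) (B k) \<noteq> \<infinity>" for k
    unfolding B_def by (subst emeasure_eucl_lborel_ball) auto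
  ultimately show "\<exists>A. countable A \<and> A \<subseteq> sets (eucl_lborel n) \<and> \<Union> A = space (eucl_lborel n) \<and> (\<forall>a\<in>A. emeasure (eucl_lborel n) a \<noteq> \<infinity>)"
    by (intro exI[of _ "range B"] conjI ballI) auto
qed

section \<open>Linear changes of variables\<close>

text \<open>With the other coordinates fixed, \<open>indep\<close> makes \<open>g\<close> a
  constant, and the claim is the affine substitution on the line.\<close>

lemma nn_integral_eucl_lborel_shear:
  fixes f :: "(nat \<Rightarrow> real) \<Rightarrow> ennreal"
  assumes f: "f \<in> borel_measurable borel" and g: "g \<in> borel_measurable borel"
    and k: "k < n" and a: "a > 0" and indep: "\<And>x y. g (x(k := y)) = g x"
  shows "ennreal a * (\<integral>\<^sup>+x. f (x(k := a * x k + g x)) \<partial>eucl_lborel n) = (\<integral>\<^sup>+x. f x \<partial>eucl_lborel n)"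
proof -
  have m: "(\<lambda>x. x(k := a * x k + g x)) \<in> borel_measurable borel"
    by (rule measurable_fun_upd_real) (use g in measurable)
  have h: "(\<lambda>x. f (x(k := a * x k + g x))) \<in> borel_measurable borel"
    by (rule measurable_compose[OF m f])
  have upd: "(\<lambda>y. f (x(k := y))) \<in> borel_measurable borel" for x
    by (rule measurable_compose[OF measurable_fun_upd_real f]) simp_all
  have inner: "(\<integral>\<^sup>+y. ennreal a * f (x(k := a * y + t)) \<partial>lborel) = (\<integral>\<^sup>+y. f (x(k := y)) \<partial>lborel)"
    for x t
  proof -
    have "(\<lambda>y. f (x(k := a * y + t))) \<in> borel_measurable lborel"
      by (rule measurable_compose[OF measurable_fun_upd_real f]) simp_all
    then show ?thesis
      using nn_integral_real_affine[OF upd, of a x t] a by (simp add: nn_integral_cmult add.commute)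
  qed
  have "ennreal a * (\<integral>\<^sup>+x. f (x(k := a * x k + g x)) \<partial>eucl_lborel n)
      = (\<integral>\<^sup>+x. ennreal a * f (x(k := a * x k + g x)) \<partial>eucl_lborel n)"
    by (rule nn_integral_cmult[symmetric]) (simp add: h cong: measurable_cong_sets)
  also have "\<dots> = (\<integral>\<^sup>+x. \<integral>\<^sup>+y. ennreal a * f ((extend0 n x)(k := a * y + g (extend0 n x))) \<partial>lborel
      \<partial>PiM ({..<n} - {k}) (\<lambda>_. lborel))"
    by (subst nn_integral_eucl_lborel_coord[OF _ k])
      (rule borel_measurable_times_ennreal[OF borel_measurable_const h], simp add: indep)
  also have "\<dots> = (\<integral>\<^sup>+x. \<integral>\<^sup>+y. f ((extend0 n x)(k := y)) \<partial>lborel \<partial>PiM ({..<n} - {k}) (\<lambda>_. lborel))"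
    by (simp only: inner)
  also have "\<dots>
      = (\<integral>\<^sup>+x. f x \<partial>eucl_lborel n)"
    by (rule nn_integral_eucl_lborel_coord[OF f k, symmetric])
  finally show ?thesis .
qed

text \<open>An upper triangular affine map is a composition of shears in increasing order of the
  coordinates: when coordinate \<open>k\<close> is replaced, the later ones, from which row
  \<open>k\<close> is computed, still have their original values. The branch \<open>else x i\<close>
  lets the intermediate maps of the induction have the same form as the final one.\<close>

lemma nn_integral_eucl_lborel_triangular:
  fixes f :: "(nat \<Rightarrow> real) \<Rightarrow> ennreal"
  assumes f: "f \<in> borel_measurable borel"
    and tri: "\<And>i j. j < i \<Longrightarrow> R i j = 0" and pos: "\<And>i. i < n \<Longrightarrow> R i i > (0::real)"
  shows "ennreal (\<Prod>i<n. R i i) *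
      (\<integral>\<^sup>+x. f (\<lambda>i. if i < n then (\<Sum>j<n. R i j * x j) + v i else x i) \<partial>eucl_lborel n) = (\<integral>\<^sup>+x. f x \<partial>eucl_lborel n)"
proof -
  have "ennreal (\<Prod>i<k. R i i) *
      (\<integral>\<^sup>+x. f (\<lambda>i. if i < k then (\<Sum>j<n. R i j * x j) + v i else x i) \<partial>eucl_lborel n) = (\<integral>\<^sup>+x. f x \<partial>eucl_lborel n)"
    if "k \<le> n" for k
    using that f
  proof (induction k arbitrary: f)
    case (Suc k)
    define g where "g x = (\<Sum>j\<in>{k<..<n}. R k j * x j) + v k" for x
    have g: "g \<in> borel_measurable borel" unfolding g_def by measurable
    define S where "S x = x(k := R k k * x k + g x)" for x
    have S: "S \<in> borel_measurable borel"
      unfolding S_def by (rule measurable_fun_upd_real) (use g in measurable)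
    have fS: "(\<lambda>x. f (S x)) \<in> borel_measurable borel" by (rule measurable_compose[OF S Suc.prems(2)])
    have split: "{..<n} = {..<k} \<union> ({k} \<union> {k<..<n})" using Suc.prems(1) by auto
    have sum_split: "(\<Sum>j<n. R k j * x j) = R k k * x k + (\<Sum>j\<in>{k<..<n}. R k j * x j)" for x
    proof -
      have "(\<Sum>j<n. R k j * x j) = (\<Sum>j<k. R k j * x j) + (\<Sum>j\<in>{k} \<union> {k<..<n}. R k j * x j)"
        unfolding split by (rule sum.union_disjoint) auto
      also have "(\<Sum>j<k. R k j * x j) = 0" by (rule sum.neutral) (simp add: tri)
      finally show ?thesis by simp
    qed
    have comp: "(\<lambda>i. if i < Suc k then (\<Sum>j<n. R i j * x j) + v i else x i) =
        S (\<lambda>i. if i < k then (\<Sum>j<n. R i j * x j) + v i else x i)" for x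
      unfolding S_def g_def by (rule ext) (simp add: sum_split less_Suc_eq)
    have Rk: "0 \<le> R k k" and P: "0 \<le> (\<Prod>i<k. R i i)"
      using pos Suc.prems(1) by (auto intro!: prod_nonneg intro: less_imp_le)
    have "ennreal (\<Prod>i<Suc k. R i i) *
        (\<integral>\<^sup>+x. f (\<lambda>i. if i < Suc k then (\<Sum>j<n. R i j * x j) + v i else x i) \<partial>eucl_lborel n) =
      ennreal (R k k) * (ennreal (\<Prod>i<k. R i i) *
        (\<integral>\<^sup>+x. f (S (\<lambda>i. if i < k then (\<Sum>j<n. R i j * x j) + v i else x i)) \<partial>eucl_lborel n))"
      unfolding comp using Rk P by (simp add: ennreal_mult mult.assoc mult.commute mult.left_commute)
    also have "\<dots> = ennreal (R k k) * (\<integral>\<^sup>+x. f (S x) \<partial>eucl_lborel n)"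
      by (subst Suc.IH[OF _ fS]) (use Suc.prems(1) in simp_all)
    also have "\<dots> = (\<integral>\<^sup>+x. f x \<partial>eucl_lborel n)"
      unfolding S_def by (rule nn_integral_eucl_lborel_shear[OF Suc.prems(2) g])
        (use Suc.prems(1) pos in \<open>auto simp: g_def\<close>)
    finally show ?case .
  qed simp
  from this[of n] show ?thesis by simp
qed

lemma nn_integral_eucl_lborel_translate:
  assumes f: "f \<in> borel_measurable borel" and v: "v \<in> eucl n"
  shows "(\<integral>\<^sup>+x. f (x + v) \<partial>eucl_lborel n) = (\<integral>\<^sup>+x. f x \<partial>eucl_lborel n)"
proof -
  have "(\<lambda>i. if i < n then (\<Sum>j<n. (if i = j then 1 else 0) * x j) + v i else x i) = x + v" for x
    using v by (auto simp: fun_eq_iff in_eucl_iff if_distrib[of "\<lambda>a. a * _"] cong: if_cong)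
  then show ?thesis
    using nn_integral_eucl_lborel_triangular[OF f, of "\<lambda>i j. if i = j then 1 else 0" n v] by simp
qed

lemma nn_integral_eucl_lborel_scale:
  assumes f: "f \<in> borel_measurable borel" and s: "s > 0"
  shows "ennreal (s ^ n) * (\<integral>\<^sup>+x. f (s *\<^sub>R x) \<partial>eucl_lborel n) = (\<integral>\<^sup>+x. f x \<partial>eucl_lborel n)"
proof -
  have *: "(\<lambda>i. if i < n then (\<Sum>j<n. (if i = j then s else 0) * x j) + 0 else x i) = s *\<^sub>R x"
    if "x \<in> eucl n" for x
    using that by (auto simp: fun_eq_iff scaleR_fun_def in_eucl_iff if_distrib[of "\<lambda>a. a * _"] cong: if_cong)
  have "(\<integral>\<^sup>+x. f (\<lambda>i. if i < n then (\<Sum>j<n. (if i = j then s else 0) * x j) + 0 else x i) \<partial>eucl_lborel n)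
      = (\<integral>\<^sup>+x. f (s *\<^sub>R x) \<partial>eucl_lborel n)"
    by (rule nn_integral_cong_AE[OF AE_mp[OF AE_eucl_lborel_eucl AE_I2]], rule impI) (simp only: *)
  then show ?thesis
    using nn_integral_eucl_lborel_triangular[OF f, of "\<lambda>i j. if i = j then s else 0" n "\<lambda>_. 0"] s by simp
qed

text \<open>Pulling the indicator of \<open>B\<close> back along the map avoids measuring an image
  set. All volume bounds by inclusion below take this form.\<close>

lemma emeasure_eucl_lborel_triangular_le:
  assumes A: "A \<in> sets borel" and B: "B \<in> sets borel"
    and tri: "\<And>i j. j < i \<Longrightarrow> R i j = 0" and pos: "\<And>i. i < n \<Longrightarrow> R i i > (0::real)"
    and AB: "\<And>x. x \<in> A \<Longrightarrow> x \<in> eucl n \<Longrightarrow> (\<lambda>i. if i < n then (\<Sum>j<n. R i j * x j) + v i else 0) \<in> B"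
  shows "ennreal (\<Prod>i<n. R i i) * emeasure (eucl_lborel n) A \<le> emeasure (eucl_lborel n) B"
proof -
  let ?T = "\<lambda>x i. if i < n then (\<Sum>j<n. R i j * x j) + v i else x i"
  have "?T x \<in> B" if "x \<in> A" "x \<in> eucl n" for x
  proof -
    have "?T x = (\<lambda>i. if i < n then (\<Sum>j<n. R i j * x j) + v i else 0)"
      using that(2) by (auto simp: fun_eq_iff in_eucl_iff)
    with AB[OF that] show ?thesis by (simp only:)
  qed
  then have "emeasure (eucl_lborel n) A \<le> (\<integral>\<^sup>+x. indicator B (?T x) \<partial>eucl_lborel n)"
    using A by (subst nn_integral_indicator[symmetric], simp)
      (rule nn_integral_mono_AE, rule AE_mp[OF AE_eucl_lborel_eucl], rule AE_I2, auto simp: indicator_def)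
  then have "ennreal (\<Prod>i<n. R i i) * emeasure (eucl_lborel n) A \<le>
      ennreal (\<Prod>i<n. R i i) * (\<integral>\<^sup>+x. indicator B (?T x) \<partial>eucl_lborel n)"
    by (rule mult_left_mono) simp
  also have "\<dots> = (\<integral>\<^sup>+x. indicator B x \<partial>eucl_lborel n)"
    by (rule nn_integral_eucl_lborel_triangular[OF _ tri pos]) (use B in simp_all)
  finally show ?thesis using B by simp
qed

section \<open>Invariance of the measure under orthogonal maps\<close>

lemma borel_measurable_plus_fun:
  fixes f g :: "'a \<Rightarrow> nat \<Rightarrow> real"
  assumes "f \<in> borel_measurable M" "g \<in> borel_measurable M"
  shows "(\<lambda>x. f x + g x) \<in> borel_measurable M"
  unfolding borel_measurable_coordinatewise_iff
proof
  fix i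
  show "(\<lambda>x. (f x + g x) i) \<in> borel_measurable M"
    unfolding plus_fun_def
    by (rule borel_measurable_add[OF assms[THEN measurable_product_then_coordinatewise]])
qed

lemma borel_measurable_minus_fun:
  fixes f g :: "'a \<Rightarrow> nat \<Rightarrow> real"
  assumes "f \<in> borel_measurable M" "g \<in> borel_measurable M"
  shows "(\<lambda>x. f x - g x) \<in> borel_measurable M"
  unfolding borel_measurable_coordinatewise_iff
proof
  fix i
  show "(\<lambda>x. (f x - g x) i) \<in> borel_measurable M"
    unfolding fun_diff_def
    by (rule borel_measurable_diff[OF assms[THEN measurable_product_then_coordinatewise]])
qed

lemma closed_L2_ball: "closed {x :: nat \<Rightarrow> real. L2_set x {..<n} \<le> r}"
  by (intro closed_Collect_le continuous_on_L2_set continuous_on_const)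

lemma pair_sigma_finite_eucl_lborel: "pair_sigma_finite (eucl_lborel m) (eucl_lborel n)"
  by (intro pair_sigma_finite.intro sigma_finite_eucl_lborel)

text \<open>As in the uniqueness proof for Haar measure, \<open>\<integral>\<integral> 1\<^sub>B (Q x - y) g y\<close> is evaluated in both orders
  for the unit ball \<open>B\<close>, which \<open>Q\<close> preserves.\<close>

lemma nn_integral_eucl_lborel_isometry:
  fixes g :: "(nat \<Rightarrow> real) \<Rightarrow> ennreal"
  assumes g: "g \<in> borel_measurable borel" and Q: "Q \<in> borel_measurable borel"
    and add: "\<And>x y. Q (x + y) = Q x + Q y"
    and iso: "\<And>x. L2_set (Q x) {..<n} = L2_set x {..<n}"
    and eucl: "\<And>x. Q x \<in> eucl n"
    and surj: "\<And>v. v \<in> eucl n \<Longrightarrow> \<exists>w\<in>eucl n. Q w = v"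
  shows "(\<integral>\<^sup>+x. g (Q x) \<partial>eucl_lborel n) = (\<integral>\<^sup>+x. g x \<partial>eucl_lborel n)"
proof -
  interpret pair_sigma_finite "eucl_lborel n" "eucl_lborel n" by (rule pair_sigma_finite_eucl_lborel)
  define I :: "(nat \<Rightarrow> real) \<Rightarrow> ennreal" where "I = indicator {x. L2_set x {..<n} \<le> 1}"
  define c where "c = emeasure (eucl_lborel n) {x. L2_set x {..<n} \<le> 1}"
  have I: "I \<in> borel_measurable borel"
    unfolding I_def by (intro borel_measurable_indicator borel_closed closed_L2_ball)
  have c: "c \<noteq> 0" "c \<noteq> \<infinity>"
    unfolding c_def using unit_ball_vol_pos[of "real n"] by (simp_all add: emeasure_eucl_lborel_ball del: unit_ball_vol_pos)
  have intI: "(\<integral>\<^sup>+x. I x \<partial>eucl_lborel n) = c"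
    unfolding I_def c_def by (rule nn_integral_indicator) (simp add: borel_closed closed_L2_ball)
  have IQ: "I (Q x) = I x" for x unfolding I_def by (simp add: indicator_def iso)
  \<comment> \<open>A translation after \<open>Q\<close> is a translation before \<open>Q\<close>,
    because \<open>Q\<close> is additive and onto \<open>eucl n\<close>; so the known translation
    invariance applies.\<close>
  have transQ: "(\<integral>\<^sup>+x. h (Q x + v) \<partial>eucl_lborel n) = (\<integral>\<^sup>+x. h (Q x) \<partial>eucl_lborel n)"
    if h: "h \<in> borel_measurable borel" and v: "v \<in> eucl n" for h :: "_ \<Rightarrow> ennreal" and v
  proof -
    obtain w where w: "w \<in> eucl n" "Q w = v" using surj[OF v] by blast
    then have "h (Q x + v) = h (Q (x + w))" for x by (simp add: add)
    then show ?thesis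
      using nn_integral_eucl_lborel_translate[OF measurable_compose[OF Q h] w(1)] by simp
  qed
  have fst: "fst \<in> borel_measurable (eucl_lborel n \<Otimes>\<^sub>M eucl_lborel n)" and snd: "snd \<in> borel_measurable (eucl_lborel n \<Otimes>\<^sub>M eucl_lborel n)"
    using measurable_fst[of "eucl_lborel n" "eucl_lborel n"] measurable_snd[of "eucl_lborel n" "eucl_lborel n"]
    by (simp_all only: measurable_to_eucl_lborel)
  have Qm: "(\<lambda>p. Q (fst p)) \<in> borel_measurable (eucl_lborel n \<Otimes>\<^sub>M eucl_lborel n)" by (rule measurable_compose[OF fst Q])
  have gsnd: "(\<lambda>p. g (snd p)) \<in> borel_measurable (eucl_lborel n \<Otimes>\<^sub>M eucl_lborel n)"
    by (rule measurable_compose[OF snd g])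
  have Isnd: "(\<lambda>p. I (snd p)) \<in> borel_measurable (eucl_lborel n \<Otimes>\<^sub>M eucl_lborel n)"
    by (rule measurable_compose[OF snd I])
  have diff: "(\<lambda>p. Q (fst p) - snd p) \<in> borel_measurable (eucl_lborel n \<Otimes>\<^sub>M eucl_lborel n)"
    by (rule borel_measurable_minus_fun[OF Qm snd])
  have sum: "(\<lambda>p. Q (fst p) + snd p) \<in> borel_measurable (eucl_lborel n \<Otimes>\<^sub>M eucl_lborel n)"
    by (rule borel_measurable_plus_fun[OF Qm snd])
  have Idiff: "(\<lambda>p. I (Q (fst p) - snd p)) \<in> borel_measurable (eucl_lborel n \<Otimes>\<^sub>M eucl_lborel n)"
    by (rule measurable_compose[OF diff I])
  have gsum: "(\<lambda>p. g (Q (fst p) + snd p)) \<in> borel_measurable (eucl_lborel n \<Otimes>\<^sub>M eucl_lborel n)"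
    by (rule measurable_compose[OF sum g])
  have m1: "(\<lambda>p. I (Q (fst p) - snd p) * g (snd p)) \<in> borel_measurable (eucl_lborel n \<Otimes>\<^sub>M eucl_lborel n)"
    by (rule borel_measurable_times_ennreal[OF Idiff gsnd])
  have m2: "(\<lambda>p. I (snd p) * g (Q (fst p) + snd p)) \<in> borel_measurable (eucl_lborel n \<Otimes>\<^sub>M eucl_lborel n)"
    by (rule borel_measurable_times_ennreal[OF Isnd gsum])
  have minus_eucl: "- y \<in> eucl n" if "y \<in> eucl n" for y
    using that by (simp add: in_eucl_iff)
  have "c * (\<integral>\<^sup>+x. g x \<partial>eucl_lborel n) = (\<integral>\<^sup>+y. c * g y \<partial>eucl_lborel n)"
    by (rule nn_integral_cmult[symmetric]) (simp add: g)
  also have "\<dots> = (\<integral>\<^sup>+y. \<integral>\<^sup>+x. I (Q x - y) * g y \<partial>eucl_lborel n \<partial>eucl_lborel n)"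
  proof (rule nn_integral_cong_AE[OF AE_mp[OF AE_eucl_lborel_eucl AE_I2]], rule impI)
    fix y :: "nat \<Rightarrow> real" assume y: "y \<in> eucl n"
    have "(\<integral>\<^sup>+x. I (Q x - y) * g y \<partial>eucl_lborel n) = (\<integral>\<^sup>+x. I (Q x + - y) \<partial>eucl_lborel n) * g y"
      using nn_integral_multc[of "\<lambda>x. I (Q x + - y)" "eucl_lborel n" "g y"]
        measurable_compose[OF borel_measurable_plus_fun[OF Q borel_measurable_const] I, of "- y"] by simp
    also have "\<dots> = c * g y" by (simp only: transQ[OF I minus_eucl[OF y]] IQ intI)
    finally show "c * g y = (\<integral>\<^sup>+x. I (Q x - y) * g y \<partial>eucl_lborel n)" ..
  qed
  also have "\<dots> = (\<integral>\<^sup>+x. \<integral>\<^sup>+y. I (Q x - y) * g y \<partial>eucl_lborel n \<partial>eucl_lborel n)"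
    using Fubini'[of "\<lambda>x y. I (Q x - y) * g y"] m1 by (simp add: case_prod_beta')
  \<comment> \<open>The substitution of \<open>y + Q x\<close> for \<open>y\<close> turns
    \<open>Q x - y\<close> into \<open>- y\<close>, and the ball is symmetric.\<close>
  also have "\<dots> = (\<integral>\<^sup>+x. \<integral>\<^sup>+y. I y * g (Q x + y) \<partial>eucl_lborel n \<partial>eucl_lborel n)"
  proof (rule nn_integral_cong)
    fix x
    have *: "(\<lambda>y. I (Q x - y) * g y) \<in> borel_measurable borel"
      by (rule borel_measurable_times_ennreal[OF measurable_compose[OF borel_measurable_minus_fun[OF
            borel_measurable_const measurable_ident_sets[OF refl]] I] g])
    have "I (- y) = I y" for y unfolding I_def by (simp add: indicator_def L2_set_def)
    moreover have "Q x - (y + Q x) = - y" for y by simp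
    ultimately have "I (Q x - (y + Q x)) * g (y + Q x) = I y * g (Q x + y)" for y
      by (simp only: add.commute)
    then show "(\<integral>\<^sup>+y. I (Q x - y) * g y \<partial>eucl_lborel n) = (\<integral>\<^sup>+y. I y * g (Q x + y) \<partial>eucl_lborel n)"
      using nn_integral_eucl_lborel_translate[OF * eucl, of x] by simp
  qed
  also have "\<dots> = (\<integral>\<^sup>+y. \<integral>\<^sup>+x. I y * g (Q x + y) \<partial>eucl_lborel n \<partial>eucl_lborel n)"
    using Fubini'[of "\<lambda>x y. I y * g (Q x + y)"] m2 by (simp add: case_prod_beta')
  also have "\<dots> = (\<integral>\<^sup>+y. I y * (\<integral>\<^sup>+x. g (Q x) \<partial>eucl_lborel n) \<partial>eucl_lborel n)"
  proof (rule nn_integral_cong_AE[OF AE_mp[OF AE_eucl_lborel_eucl AE_I2]], rule impI)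
    fix y :: "nat \<Rightarrow> real" assume y: "y \<in> eucl n"
    have "(\<integral>\<^sup>+x. I y * g (Q x + y) \<partial>eucl_lborel n) = I y * (\<integral>\<^sup>+x. g (Q x + y) \<partial>eucl_lborel n)"
      using nn_integral_cmult[of "\<lambda>x. g (Q x + y)" "eucl_lborel n" "I y"]
        measurable_compose[OF borel_measurable_plus_fun[OF Q borel_measurable_const] g, of y] by simp
    then show "(\<integral>\<^sup>+x. I y * g (Q x + y) \<partial>eucl_lborel n) = I y * (\<integral>\<^sup>+x. g (Q x) \<partial>eucl_lborel n)"
      by (simp only: transQ[OF g y])
  qed
  also have "\<dots> = (\<integral>\<^sup>+y. I y \<partial>eucl_lborel n) * (\<integral>\<^sup>+x. g (Q x) \<partial>eucl_lborel n)"
    by (rule nn_integral_multc) (simp only: measurable_eucl_lborel I)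
  finally have "c * (\<integral>\<^sup>+x. g x \<partial>eucl_lborel n) = c * (\<integral>\<^sup>+x. g (Q x) \<partial>eucl_lborel n)"
    unfolding intI .
  then show ?thesis using c unfolding ennreal_mult_cancel_left infinity_ennreal_def
    by (elim disjE conjE) simp_all
qed

section \<open>Integration along rays\<close>

lemma borel_measurable_scaleR_fun:
  fixes f :: "'a \<Rightarrow> real" and g :: "'a \<Rightarrow> nat \<Rightarrow> real"
  assumes "f \<in> borel_measurable M" "g \<in> borel_measurable M"
  shows "(\<lambda>x. f x *\<^sub>R g x) \<in> borel_measurable M"
  unfolding borel_measurable_coordinatewise_iff
proof
  fix i
  show "(\<lambda>x. (f x *\<^sub>R g x) i) \<in> borel_measurable M"
    unfolding scaleR_fun_def real_scaleR_def
    by (rule borel_measurable_times[OF assms(1) assms(2)[THEN measurable_product_then_coordinatewise]])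
qed

lemma L2_set_scaleR: "L2_set (s *\<^sub>R x) A = \<bar>s\<bar> * L2_set x A"
  unfolding L2_set_def scaleR_fun_def
  by (simp add: power_mult_distrib sum_distrib_left[symmetric] real_sqrt_mult)

text \<open>The condition \<open>1 \<le> t / s \<le> 2\<close> says that \<open>s\<close> lies
  between \<open>t / 2\<close> and \<open>t\<close>. Since \<open>ds / s\<close> is invariant under
  scaling, the result does not depend on \<open>t\<close>.\<close>

lemma nn_integral_inverse_annulus:
  assumes "t > (0::real)"
  shows "(\<integral>\<^sup>+s. ennreal (1 / s) * (indicator {0<..} s * indicator {1..2} (t / s)) \<partial>lborel) = ennreal (ln 2)"
proof -
  have "(\<integral>\<^sup>+s. ennreal (1 / s) * (indicator {0<..} s * indicator {1..2} (t / s)) \<partial>lborel) =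
      (\<integral>\<^sup>+s. ennreal (1 / s) * indicator {t / 2..t} s \<partial>lborel)"
    using assms by (intro nn_integral_cong) (auto simp: indicator_def field_simps)
  also have "\<dots> = ln t - ln (t / 2)"
    using assms by (intro nn_integral_FTC_Icc) (auto intro!: derivative_eq_intros simp: field_simps)
  also have "\<dots> = ennreal (ln 2)" using assms by (simp add: ln_div)
  finally show ?thesis .
qed

text \<open>A substitute for polar coordinates: each \<open>x\<close> of the annulus \<open>1 \<le> |x| \<le> 2\<close> represents its ray.\<close>

lemma nn_integral_eucl_lborel_polar:
  fixes F :: "(nat \<Rightarrow> real) \<Rightarrow> ennreal"
  assumes F: "F \<in> borel_measurable borel"
  shows "(\<integral>\<^sup>+x. (\<integral>\<^sup>+s. F (s *\<^sub>R x) * (ennreal (s ^ n / s) * indicator {0<..} s) \<partial>lborel)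
        * indicator {1..2} (L2_set x {..<n}) \<partial>eucl_lborel n)
    = (\<integral>\<^sup>+x. F x * (ennreal (ln 2) * indicator {0<..} (L2_set x {..<n})) \<partial>eucl_lborel n)"
proof -
  interpret pair_sigma_finite "eucl_lborel n" "lborel :: real measure"
    by (intro pair_sigma_finite.intro sigma_finite_eucl_lborel sigma_finite_lborel)
  \<comment> \<open>The usual polar weight of exponent \<open>n - 1\<close>, written as a quotient
    so that no truncated subtraction arises at \<open>n = 0\<close>.\<close>
  define w :: "real \<Rightarrow> ennreal" where "w s = ennreal (s ^ n / s) * indicator {0<..} s" for s
  define ch :: "real \<Rightarrow> ennreal" where "ch = indicator {1..2}"
  let ?N = "\<lambda>x :: nat \<Rightarrow> real. L2_set x {..<n}"
  let ?P = "eucl_lborel n \<Otimes>\<^sub>M (lborel :: real measure)"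
  have w: "w \<in> borel_measurable borel" unfolding w_def by measurable
  have ch: "ch \<in> borel_measurable borel" unfolding ch_def by measurable
  have fst: "fst \<in> borel_measurable ?P"
    using measurable_fst[of "eucl_lborel n" "lborel :: real measure"] by (simp only: measurable_to_eucl_lborel)
  have snd: "snd \<in> borel_measurable ?P"
    using measurable_snd[of "eucl_lborel n" "lborel :: real measure"] by (simp only: measurable_lborel1 measurable_lborel2)
  have sx: "(\<lambda>p. F (snd p *\<^sub>R fst p)) \<in> borel_measurable ?P"
    by (rule measurable_compose[OF borel_measurable_scaleR_fun[OF snd fst] F])
  have N: "(\<lambda>p. ?N (fst p)) \<in> borel_measurable ?P"
    by (rule measurable_compose[OF fst borel_measurable_L2_set])
  have Fx: "(\<lambda>p. F (fst p)) \<in> borel_measurable ?P" by (rule measurable_compose[OF fst F])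
  have ws: "(\<lambda>p. w (snd p)) \<in> borel_measurable ?P" by (rule measurable_compose[OF snd w])
  have chN: "(\<lambda>p. ch (?N (fst p))) \<in> borel_measurable ?P" by (rule measurable_compose[OF N ch])
  have chNs: "(\<lambda>p. ch (?N (fst p) / snd p)) \<in> borel_measurable ?P"
    by (rule measurable_compose[OF borel_measurable_divide[OF N snd] ch])
  have inv: "(\<lambda>s. ennreal (1 / s) * indicator {0<..} s) \<in> borel_measurable (borel :: real measure)"
    by measurable
  have invs: "(\<lambda>p. ennreal (1 / snd p) * indicator {0<..} (snd p)) \<in> borel_measurable ?P"
    by (rule measurable_compose[OF snd inv])
  have m1: "(\<lambda>p. F (snd p *\<^sub>R fst p) * w (snd p) * ch (?N (fst p))) \<in> borel_measurable ?P"
    by (rule borel_measurable_times_ennreal[OF borel_measurable_times_ennreal[OF sx ws] chN])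
  have m2: "(\<lambda>p. ennreal (1 / snd p) * indicator {0<..} (snd p) * (F (fst p) * ch (?N (fst p) / snd p)))
      \<in> borel_measurable ?P"
    by (rule borel_measurable_times_ennreal[OF invs borel_measurable_times_ennreal[OF Fx chNs]])
  have Fs: "(\<lambda>x. F (s *\<^sub>R x)) \<in> borel_measurable borel" for s
    by (rule measurable_compose[OF borel_measurable_scaleR_fun[OF borel_measurable_const
          measurable_ident_sets[OF refl]] F])
  have sF: "(\<lambda>s. F (s *\<^sub>R x)) \<in> borel_measurable borel" for x
    by (rule measurable_compose[OF borel_measurable_scaleR_fun[OF
          measurable_ident_sets[OF refl] borel_measurable_const] F])
  have "(\<integral>\<^sup>+x. (\<integral>\<^sup>+s. F (s *\<^sub>R x) * w s \<partial>lborel) * ch (?N x) \<partial>eucl_lborel n)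
      = (\<integral>\<^sup>+x. \<integral>\<^sup>+s. F (s *\<^sub>R x) * w s * ch (?N x) \<partial>lborel \<partial>eucl_lborel n)"
  proof (rule nn_integral_cong)
    fix x
    have "(\<lambda>s. F (s *\<^sub>R x) * w s) \<in> borel_measurable lborel"
      using borel_measurable_times_ennreal[OF sF w] by simp
    then show "(\<integral>\<^sup>+s. F (s *\<^sub>R x) * w s \<partial>lborel) * ch (?N x) =
        (\<integral>\<^sup>+s. F (s *\<^sub>R x) * w s * ch (?N x) \<partial>lborel)"
      by (rule nn_integral_multc[symmetric])
  qed
  also have "\<dots> = (\<integral>\<^sup>+s. \<integral>\<^sup>+x. F (s *\<^sub>R x) * w s * ch (?N x) \<partial>eucl_lborel n \<partial>lborel)"
    using Fubini'[of "\<lambda>x s. F (s *\<^sub>R x) * w s * ch (?N x)"] m1 by (simp only: case_prod_beta')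
  \<comment> \<open>For fixed \<open>s > 0\<close>, substituting \<open>s *\<^sub>R x\<close> in the
    integral over \<open>x\<close> absorbs \<open>s ^ n\<close> and leaves \<open>1 / s\<close>; the
    annulus is dilated by \<open>s\<close>. The integral over \<open>s\<close> then concerns only
    the scale-invariant weight.\<close>
  also have "\<dots> = (\<integral>\<^sup>+s. \<integral>\<^sup>+x. ennreal (1 / s) * indicator {0<..} s * (F x * ch (?N x / s)) \<partial>eucl_lborel n \<partial>lborel)"
  proof (rule nn_integral_cong)
    fix s :: real
    show "(\<integral>\<^sup>+x. F (s *\<^sub>R x) * w s * ch (?N x) \<partial>eucl_lborel n)
      = (\<integral>\<^sup>+x. ennreal (1 / s) * indicator {0<..} s * (F x * ch (?N x / s)) \<partial>eucl_lborel n)"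
    proof (cases "s > 0")
      case True
      have Nm: "(\<lambda>x. ch (?N x / s)) \<in> borel_measurable borel"
        by (rule measurable_compose[OF borel_measurable_divide[OF borel_measurable_L2_set borel_measurable_const] ch])
      have G: "(\<lambda>x. F x * ch (?N x / s)) \<in> borel_measurable borel"
        by (rule borel_measurable_times_ennreal[OF F Nm])
      have Gs: "(\<lambda>x. F (s *\<^sub>R x) * ch (?N (s *\<^sub>R x) / s)) \<in> borel_measurable borel"
        by (rule measurable_compose[OF borel_measurable_scaleR_fun[OF borel_measurable_const
          measurable_ident_sets[OF refl]] G])
      have ws: "w s = ennreal (1 / s) * ennreal (s ^ n)"
        using True unfolding w_def by (simp add: ennreal_mult[symmetric])
      have "(\<integral>\<^sup>+x. F (s *\<^sub>R x) * w s * ch (?N x) \<partial>eucl_lborel n) =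
          (\<integral>\<^sup>+x. w s * (F (s *\<^sub>R x) * ch (?N (s *\<^sub>R x) / s)) \<partial>eucl_lborel n)"
        using True by (simp add: L2_set_scaleR ac_simps)
      also have "\<dots> = w s * (\<integral>\<^sup>+x. F (s *\<^sub>R x) * ch (?N (s *\<^sub>R x) / s) \<partial>eucl_lborel n)"
        by (rule nn_integral_cmult) (simp only: measurable_eucl_lborel Gs)
      also have "\<dots> = ennreal (1 / s) * (\<integral>\<^sup>+x. F x * ch (?N x / s) \<partial>eucl_lborel n)"
        unfolding ws mult.assoc nn_integral_eucl_lborel_scale[OF G True] ..
      also have "\<dots> = (\<integral>\<^sup>+x. ennreal (1 / s) * (F x * ch (?N x / s)) \<partial>eucl_lborel n)"
        by (rule nn_integral_cmult[symmetric]) (simp only: measurable_eucl_lborel G)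
      finally show ?thesis using True by simp
    qed (simp add: w_def)
  qed
  also have "\<dots> = (\<integral>\<^sup>+x. \<integral>\<^sup>+s. ennreal (1 / s) * indicator {0<..} s * (F x * ch (?N x / s)) \<partial>lborel \<partial>eucl_lborel n)"
    using Fubini'[of "\<lambda>x s. ennreal (1 / s) * indicator {0<..} s * (F x * ch (?N x / s))"] m2
    by (simp only: case_prod_beta')
  also have "\<dots> = (\<integral>\<^sup>+x. F x * (ennreal (ln 2) * indicator {0<..} (?N x)) \<partial>eucl_lborel n)"
  proof (rule nn_integral_cong)
    fix x :: "nat \<Rightarrow> real"
    have "(\<lambda>s. ch (?N x / s)) \<in> borel_measurable borel"
      by (rule measurable_compose[OF borel_measurable_divide[OF borel_measurable_const
            measurable_ident_sets[OF refl]] ch])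
    from borel_measurable_times_ennreal[OF inv this]
    have m: "(\<lambda>s. ennreal (1 / s) * indicator {0<..} s * ch (?N x / s)) \<in> borel_measurable lborel"
      by (simp only: measurable_lborel1 measurable_lborel2)
    have "(\<integral>\<^sup>+s. ennreal (1 / s) * indicator {0<..} s * (F x * ch (?N x / s)) \<partial>lborel) =
        (\<integral>\<^sup>+s. F x * (ennreal (1 / s) * indicator {0<..} s * ch (?N x / s)) \<partial>lborel)"
      by (simp only: mult.left_commute)
    also have "\<dots> = F x * (\<integral>\<^sup>+s. ennreal (1 / s) * indicator {0<..} s * ch (?N x / s) \<partial>lborel)"
      by (rule nn_integral_cmult[OF m])
    also have "(\<integral>\<^sup>+s. ennreal (1 / s) * indicator {0<..} s * ch (?N x / s) \<partial>lborel)
        = ennreal (ln 2) * indicator {0<..} (?N x)"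
    proof (cases "?N x > 0")
      case True
      then show ?thesis using nn_integral_inverse_annulus[OF True] unfolding ch_def by (simp add: mult.assoc)
    next
      case False
      then have "?N x = 0" using L2_set_nonneg[of x] by (simp add: order.antisym)
      then show ?thesis by (simp add: ch_def)
    qed
    finally show "(\<integral>\<^sup>+s. ennreal (1 / s) * indicator {0<..} s * (F x * ch (?N x / s)) \<partial>lborel)
        = F x * (ennreal (ln 2) * indicator {0<..} (?N x))" .
  qed
  finally show ?thesis unfolding w_def ch_def .
qed

text \<open>Reduces an inequality of integrals to one on each ray. The polar formula does not see
  the points of norm 0: \<open>F\<close> vanishes there by \<open>F0\<close>, and for
  \<open>G\<close> omitting them only lowers the smaller side of the final estimate.\<close>

lemma nn_integral_eucl_lborel_radial_mono:
  fixes F G :: "(nat \<Rightarrow> real) \<Rightarrow> ennreal"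
  assumes F: "F \<in> borel_measurable borel" and G: "G \<in> borel_measurable borel"
    and F0: "\<And>x. L2_set x {..<n} = 0 \<Longrightarrow> F x = 0"
    and ray: "\<And>x. x \<in> eucl n \<Longrightarrow> L2_set x {..<n} > 0 \<Longrightarrow>
      (\<integral>\<^sup>+s. F (s *\<^sub>R x) * (ennreal (s ^ n / s) * indicator {0<..} s) \<partial>lborel) \<le>
      (\<integral>\<^sup>+s. G (s *\<^sub>R x) * (ennreal (s ^ n / s) * indicator {0<..} s) \<partial>lborel)"
  shows "(\<integral>\<^sup>+x. F x \<partial>eucl_lborel n) \<le> (\<integral>\<^sup>+x. G x \<partial>eucl_lborel n)"
proof -
  have "F x = F x * indicator {0<..} (L2_set x {..<n})" for x
    using F0[of x] L2_set_nonneg[of x "{..<n}"] by (cases "L2_set x {..<n} = 0") (simp_all add: less_le)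
  then have "ennreal (ln 2) * (\<integral>\<^sup>+x. F x \<partial>eucl_lborel n) =
      ennreal (ln 2) * (\<integral>\<^sup>+x. F x * indicator {0<..} (L2_set x {..<n}) \<partial>eucl_lborel n)"
    by simp
  also have "\<dots> = (\<integral>\<^sup>+x. ennreal (ln 2) * (F x * indicator {0<..} (L2_set x {..<n})) \<partial>eucl_lborel n)"
  proof (rule nn_integral_cmult[symmetric])
    have "(\<lambda>x. indicator {0<..} (L2_set x {..<n}) :: ennreal) \<in> borel_measurable borel"
      by (rule measurable_compose[OF borel_measurable_L2_set]) simp
    from borel_measurable_times_ennreal[OF F this]
    show "(\<lambda>x. F x * indicator {0<..} (L2_set x {..<n})) \<in> borel_measurable (eucl_lborel n)"
      by (simp only: measurable_eucl_lborel)
  qed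
  also have "\<dots> = (\<integral>\<^sup>+x. F x * (ennreal (ln 2) * indicator {0<..} (L2_set x {..<n})) \<partial>eucl_lborel n)"
    by (simp only: mult.left_commute)
  also have "\<dots> \<le> (\<integral>\<^sup>+x. G x * (ennreal (ln 2) * indicator {0<..} (L2_set x {..<n})) \<partial>eucl_lborel n)"
    unfolding nn_integral_eucl_lborel_polar[OF F, symmetric] nn_integral_eucl_lborel_polar[OF G, symmetric]
  proof (rule nn_integral_mono_AE[OF AE_mp[OF AE_eucl_lborel_eucl AE_I2]], rule impI)
    fix x :: "nat \<Rightarrow> real" assume x: "x \<in> eucl n"
    show "(\<integral>\<^sup>+s. F (s *\<^sub>R x) * (ennreal (s ^ n / s) * indicator {0<..} s) \<partial>lborel)
        * indicator {1..2} (L2_set x {..<n})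
      \<le> (\<integral>\<^sup>+s. G (s *\<^sub>R x) * (ennreal (s ^ n / s) * indicator {0<..} s) \<partial>lborel)
        * indicator {1..2} (L2_set x {..<n})"
      using ray[OF x] by (cases "L2_set x {..<n} \<in> {1..2}") auto
  qed
  also have "\<dots> \<le> (\<integral>\<^sup>+x. ennreal (ln 2) * G x \<partial>eucl_lborel n)"
    by (rule nn_integral_mono) (simp add: indicator_def mult.commute)
  also have "\<dots> = ennreal (ln 2) * (\<integral>\<^sup>+x. G x \<partial>eucl_lborel n)"
    by (rule nn_integral_cmult) (simp only: measurable_eucl_lborel G)
  finally show ?thesis by (simp add: ennreal_mult_le_mult_iff)
qed

section \<open>Parallel bodies and balls\<close>

definition eucl_ball :: "nat \<Rightarrow> real \<Rightarrow> (nat \<Rightarrow> real) set" where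
  "eucl_ball n r = {x \<in> eucl n. L2_set x {..<n} \<le> r}"

definition parallel_body :: "nat \<Rightarrow> (nat \<Rightarrow> real) set \<Rightarrow> real \<Rightarrow> (nat \<Rightarrow> real) set" where
  "parallel_body n A e = {x + e *\<^sub>R y | x y. x \<in> A \<and> y \<in> unit_ball n}"

lemma unit_ball_eq_eucl_ball: "unit_ball n = eucl_ball n 1"
  by (simp add: unit_ball_def eucl_ball_def)

lemma closed_eucl: "closed (eucl n)"
  by (rule closedin_Euclidean_imp_closed) (rule closedin_topspace)

lemma closed_eucl_ball: "closed (eucl_ball n r)"
proof -
  have "eucl_ball n r = eucl n \<inter> {x. L2_set x {..<n} \<le> r}" by (auto simp: eucl_ball_def)
  then show ?thesis by (simp add: closed_Int closed_eucl closed_L2_ball)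
qed

lemma compactin_Euclidean_space_iff:
  "compactin (Euclidean_space n) K \<longleftrightarrow> compact K \<and> K \<subseteq> eucl n"
  unfolding Euclidean_space_def compactin_subtopology euclidean_product_topology
    compactin_euclidean_iff by simp

lemma compact_eucl_ball: "compact (eucl_ball n r)"
proof -
  have "compactin (product_topology (\<lambda>_. euclidean) UNIV) (\<Pi>\<^sub>E i\<in>UNIV. {- r..r} :: real set)"
    by (subst compactin_PiE) simp
  then have c: "compact (\<Pi>\<^sub>E i\<in>(UNIV::nat set). {- r..r})"
    unfolding euclidean_product_topology compactin_euclidean_iff .
  have "eucl_ball n r \<subseteq> (\<Pi>\<^sub>E i\<in>UNIV. {- r..r})"
  proof
    fix x assume x: "x \<in> eucl_ball n r"
    have "\<bar>x i\<bar> \<le> r" for i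
    proof (cases "i < n")
      case True
      then have "\<bar>x i\<bar> \<le> L2_set x {..<n}"
        using member_le_L2_set[of "{..<n}" i "\<lambda>i. \<bar>x i\<bar>"] by (simp add: L2_set_def)
      with x show ?thesis by (simp add: eucl_ball_def)
    next
      case False
      moreover have "0 \<le> r" using x order_trans[OF L2_set_nonneg[of x "{..<n}"]] by (simp add: eucl_ball_def)
      ultimately show ?thesis using x by (simp add: eucl_ball_def in_eucl_iff)
    qed
    then show "x \<in> (\<Pi>\<^sub>E i\<in>UNIV. {- r..r})" by (simp add: PiE_UNIV_domain abs_le_iff minus_le_iff)
  qed
  then have "eucl_ball n r = (\<Pi>\<^sub>E i\<in>UNIV. {- r..r}) \<inter> eucl_ball n r" by blast
  also have "compact \<dots>" by (rule compact_Int_closed[OF c closed_eucl_ball])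
  finally show ?thesis .
qed

lemma compact_imp_borel: "compact A \<Longrightarrow> A \<in> sets (borel :: (nat \<Rightarrow> real) measure)"
  by (intro borel_closed compact_imp_closed)

lemma continuous_on_plus_scaleR_fun:
  "continuous_on S (\<lambda>p :: (nat \<Rightarrow> real) \<times> (nat \<Rightarrow> real). fst p + e *\<^sub>R snd p)"
proof (rule continuous_on_coordinatewise_then_product)
  fix i
  have "continuous_on S (\<lambda>p :: (nat \<Rightarrow> real) \<times> (nat \<Rightarrow> real). fst p i + e * snd p i)"
    by (intro continuous_on_add continuous_on_mult continuous_on_const
      continuous_on_compose2[OF continuous_on_coord continuous_on_fst[OF continuous_on_id] subset_UNIV]
      continuous_on_compose2[OF continuous_on_coord continuous_on_snd[OF continuous_on_id] subset_UNIV])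
  then show "continuous_on S (\<lambda>p :: (nat \<Rightarrow> real) \<times> (nat \<Rightarrow> real). (fst p + e *\<^sub>R snd p) i)"
    by (simp add: scaleR_fun_def)
qed

lemma compact_parallel_body: "compact A \<Longrightarrow> compact (parallel_body n A e)"
proof -
  assume "compact A"
  then have "compact ((\<lambda>p. fst p + e *\<^sub>R snd p) ` (A \<times> eucl_ball n 1))"
    by (intro compact_continuous_image continuous_on_plus_scaleR_fun compact_Times compact_eucl_ball)
  also have "(\<lambda>p. fst p + e *\<^sub>R snd p) ` (A \<times> eucl_ball n 1) = parallel_body n A e"
    unfolding parallel_body_def unit_ball_eq_eucl_ball by force
  finally show ?thesis .
qed

lemma parallel_body_subset_eucl: "A \<subseteq> eucl n \<Longrightarrow> parallel_body n A e \<subseteq> eucl n"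
  by (auto simp: parallel_body_def unit_ball_def in_eucl_iff scaleR_fun_def)

lemma subset_parallel_body: "A \<subseteq> parallel_body n A e"
proof
  fix x assume "x \<in> A"
  moreover have "x = x + e *\<^sub>R 0" by simp
  moreover have "0 \<in> unit_ball n" by (simp add: unit_ball_def in_eucl_iff L2_set_def)
  ultimately show "x \<in> parallel_body n A e" unfolding parallel_body_def by blast
qed

lemma emeasure_eucl_lborel_eucl_ball:
  assumes "r > 0" shows "emeasure (eucl_lborel n) (eucl_ball n r) = ennreal (unit_ball_vol (real n) * r ^ n)"
proof -
  have "emeasure (eucl_lborel n) (eucl_ball n r) = emeasure (eucl_lborel n) {x. L2_set x {..<n} \<le> r}"
    by (rule emeasure_eq_AE[OF AE_mp[OF AE_eucl_lborel_eucl AE_I2]])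
      (simp_all add: eucl_ball_def[symmetric] borel_closed closed_eucl_ball closed_L2_ball, simp add: eucl_ball_def)
  then show ?thesis by (simp add: emeasure_eucl_lborel_ball assms)
qed

lemma vol_eucl_ball:
  assumes "r > 0" shows "vol n (eucl_ball n r) = unit_ball_vol (real n) * r ^ n"
proof -
  have "vol n (eucl_ball n r) = measure (eucl_lborel n) (eucl_ball n r)"
    by (rule vol_eq_eucl_lborel) (auto simp: eucl_ball_def[symmetric] borel_closed closed_eucl_ball, simp add: eucl_ball_def)
  also have "\<dots> = unit_ball_vol (real n) * r ^ n"
    using assms by (simp add: measure_def emeasure_eucl_lborel_eucl_ball)
  finally show ?thesis .
qed

lemma compact_subset_eucl_ball:
  assumes "compact K" "K \<subseteq> eucl n" obtains r where "r > 0" "K \<subseteq> eucl_ball n r"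
proof -
  have "compact ((\<lambda>x. L2_set x {..<n}) ` K)"
    by (intro compact_continuous_image continuous_on_L2_set assms)
  then obtain B where B: "\<And>x. x \<in> K \<Longrightarrow> \<bar>L2_set x {..<n}\<bar> \<le> B"
    using compact_imp_bounded by (fastforce simp: bounded_iff)
  have "K \<subseteq> eucl_ball n (max B 1)" using B assms(2) by (fastforce simp: eucl_ball_def)
  then show thesis by (intro that[of "max B 1"]) auto
qed

text \<open>\<open>vol\<close> is defined by the real-valued \<open>measure\<close>, which returns 0
  on sets of infinite measure. Compactness excludes that case, so volumes and extended integrals can
  be exchanged.\<close>

lemma emeasure_eucl_lborel_compact:
  assumes "compact K" "K \<subseteq> eucl n" shows "emeasure (eucl_lborel n) K = ennreal (vol n K)"
proof -
  obtain r where r: "r > 0" "K \<subseteq> eucl_ball n r" using compact_subset_eucl_ball[OF assms] .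
  have "emeasure (eucl_lborel n) K \<le> emeasure (eucl_lborel n) (eucl_ball n r)"
    by (rule emeasure_mono[OF r(2)]) (simp add: borel_closed closed_eucl_ball)
  also have "\<dots> < \<infinity>" by (simp add: emeasure_eucl_lborel_eucl_ball r(1))
  finally have "emeasure (eucl_lborel n) K \<noteq> \<infinity>" by simp
  then show ?thesis
    by (simp add: vol_eq_eucl_lborel[OF assms(2) compact_imp_borel[OF assms(1)]] emeasure_eq_ennreal_measure)
qed

lemma vol_nonneg [simp]: "vol n A \<ge> 0" by (simp add: vol_def)

text \<open>Along each ray, the part of the shell of \<open>L\<close> starts further out than that of the ball but
  is at least as long.\<close>

lemma vol_parallel_body_diff_ge_ball:
  assumes L: "compact L" "L \<subseteq> eucl n" and r: "r > 0" "eucl_ball n r \<subseteq> L" and e: "e > 0"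
  shows "vol n (eucl_ball n (r + e)) - vol n (eucl_ball n r) \<le> vol n (parallel_body n L e) - vol n L"
proof -
  define S where "S = eucl_ball n (r + e) - eucl_ball n r"
  define D where "D = parallel_body n L e - L"
  have cP: "compact (parallel_body n L e)" by (rule compact_parallel_body[OF L(1)])
  have pe: "parallel_body n L e \<subseteq> eucl n" by (rule parallel_body_subset_eucl[OF L(2)])
  have S: "S \<in> sets borel" unfolding S_def by (intro sets.Diff borel_closed closed_eucl_ball)
  have D: "D \<in> sets borel" unfolding D_def by (intro sets.Diff compact_imp_borel cP L(1))
  have "(\<integral>\<^sup>+x. indicator S x \<partial>eucl_lborel n) \<le> (\<integral>\<^sup>+x. indicator D x \<partial>eucl_lborel n)"
  proof (rule nn_integral_eucl_lborel_radial_mono)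
    show "indicator S x = (0::ennreal)" if "L2_set x {..<n} = 0" for x
      using that r(1) e by (auto simp: S_def eucl_ball_def)
  next
    fix x assume x: "x \<in> eucl n" and pos: "L2_set x {..<n} > 0"
    define t where "t = L2_set x {..<n}"
    have t: "t > 0" using pos by (simp add: t_def)
    have "n \<noteq> 0" using pos by (intro notI) simp
    then obtain k where k: "n = Suc k" using not0_implies_Suc by blast
    \<comment> \<open>Measured in the parameter \<open>s\<close> of the ray through
      \<open>x\<close>, the sphere of radius \<open>r\<close> is reached at \<open>a\<close>, and a
      shell of thickness \<open>e\<close> has length \<open>d\<close>.\<close>
    define a where "a = r / t"
    define d where "d = e / t"
    have sx: "s *\<^sub>R x \<in> eucl n" for s using x by (simp add: in_eucl_iff scaleR_fun_def)
    define T where "T = {s. 0 \<le> s \<and> s *\<^sub>R x \<in> L}"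
    obtain R where R: "L \<subseteq> eucl_ball n R" using compact_subset_eucl_ball[OF L] by blast
    have "continuous_on UNIV (\<lambda>s. s *\<^sub>R x)"
    proof (rule continuous_on_coordinatewise_then_product)
      show "continuous_on UNIV (\<lambda>s. (s *\<^sub>R x) i)" for i
        unfolding scaleR_fun_def real_scaleR_def by (intro continuous_intros)
    qed
    then have "closed ((\<lambda>s. s *\<^sub>R x) -` L)"
      by (intro closed_vimage compact_imp_closed L(1))
    then have "closed ({0..} \<inter> (\<lambda>s. s *\<^sub>R x) -` L)" by (intro closed_Int closed_atLeast)
    moreover have "{0..} \<inter> (\<lambda>s. s *\<^sub>R x) -` L = T" by (auto simp: T_def)
    ultimately have clT: "closed T" by simp
    have "T \<subseteq> {0..R / t}"
    proof
      fix s assume s: "s \<in> T"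
      then have "s *\<^sub>R x \<in> eucl_ball n R" "0 \<le> s" using R by (auto simp: T_def)
      then have "s * t \<le> R" by (simp add: eucl_ball_def L2_set_scaleR t_def)
      with \<open>0 \<le> s\<close> t show "s \<in> {0..R / t}" by (simp add: pos_le_divide_eq)
    qed
    then have "compact T"
      using clT compact_Icc closed_Int_compact[of T "{0..R / t}"] by (simp add: Int_absorb2)
    moreover have aT: "a \<in> T"
    proof -
      have "a *\<^sub>R x \<in> eucl_ball n r"
        using sx t r(1) by (simp add: eucl_ball_def L2_set_scaleR a_def t_def[symmetric])
      with r t show ?thesis by (auto simp: T_def a_def)
    qed
    \<comment> \<open>The last parameter at which the ray meets \<open>L\<close>. The ray may leave
      and re-enter \<open>L\<close> before, but beyond \<open>\<rho>\<close> it avoids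
      \<open>L\<close>, so the whole interval of length \<open>d\<close> after \<open>\<rho>\<close>
      lies in the shell.\<close>
    ultimately obtain \<rho> where \<rho>: "\<rho> \<in> T" "\<And>s. s \<in> T \<Longrightarrow> s \<le> \<rho>"
      using compact_attains_sup[of T] by blast
    have a\<rho>: "a \<le> \<rho>" using \<rho>(2)[OF aT] .
    have a0: "0 < a" using r t by (simp add: a_def)
    have "(\<integral>\<^sup>+s. indicator S (s *\<^sub>R x) * (ennreal (s ^ n / s) * indicator {0<..} s) \<partial>lborel) \<le>
        (\<integral>\<^sup>+s. indicator {a<..a + d} s * ennreal (s ^ k) \<partial>lborel)"
    proof (rule nn_integral_mono)
      fix s :: real
      have "s \<in> {a<..a + d}" if "s > 0" "s *\<^sub>R x \<in> S"
        using that sx t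
        by (auto simp: S_def eucl_ball_def L2_set_scaleR t_def[symmetric] a_def d_def field_simps)
      then show "indicator S (s *\<^sub>R x) * (ennreal (s ^ n / s) * indicator {0<..} s)
          \<le> indicator {a<..a + d} s * ennreal (s ^ k)"
        by (auto simp: indicator_def k)
    qed
    \<comment> \<open>Moving the interval outwards from \<open>a\<close> to \<open>\<rho>\<close>
      can only increase the integral, as the weight \<open>s ^ k\<close> is increasing.\<close>
    also have "\<dots> \<le> (\<integral>\<^sup>+s. indicator {\<rho><..\<rho> + d} ((\<rho> - a) + 1 * s) * ennreal (((\<rho> - a) + 1 * s) ^ k) \<partial>lborel)"
      using a\<rho> a0 by (intro nn_integral_mono) (auto simp: indicator_def intro!: ennreal_leI power_mono)
    also have "\<dots> = (\<integral>\<^sup>+s. indicator {\<rho><..\<rho> + d} s * ennreal (s ^ k) \<partial>lborel)"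
    proof -
      have "(\<lambda>s. indicator {\<rho><..\<rho> + d} s * ennreal (s ^ k)) \<in> borel_measurable borel" by measurable
      from nn_integral_real_affine[OF this, of 1 "\<rho> - a"] show ?thesis by simp
    qed
    also have "\<dots> \<le> (\<integral>\<^sup>+s. indicator D (s *\<^sub>R x) * (ennreal (s ^ n / s) * indicator {0<..} s) \<partial>lborel)"
    proof (rule nn_integral_mono)
      fix s :: real
      have "s *\<^sub>R x \<in> D" if s: "s \<in> {\<rho><..\<rho> + d}"
      proof -
        have "s \<notin> T" using \<rho>(2)[of s] s by auto
        then have "s *\<^sub>R x \<notin> L" using s a\<rho> a0 by (auto simp: T_def)
        moreover have "s *\<^sub>R x = \<rho> *\<^sub>R x + e *\<^sub>R (((s - \<rho>) / e) *\<^sub>R x)"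
          using e by (simp add: scaleR_add_left[symmetric])
        moreover have "((s - \<rho>) / e) *\<^sub>R x \<in> unit_ball n"
        proof -
          have "(s - \<rho>) * t \<le> e" using s t by (auto simp: d_def field_simps)
          then show ?thesis
            using sx s e by (simp add: unit_ball_def L2_set_scaleR t_def[symmetric])
        qed
        moreover have "\<rho> *\<^sub>R x \<in> L" using \<rho>(1) by (simp add: T_def)
        ultimately show ?thesis unfolding D_def parallel_body_def by blast
      qed
      moreover have "s > 0" if "s \<in> {\<rho><..\<rho> + d}" using that a\<rho> a0 by simp
      ultimately show "indicator {\<rho><..\<rho> + d} s * ennreal (s ^ k)
          \<le> indicator D (s *\<^sub>R x) * (ennreal (s ^ n / s) * indicator {0<..} s)"
        by (auto simp: indicator_def k)
    qed
    finally show "(\<integral>\<^sup>+s. indicator S (s *\<^sub>R x) * (ennreal (s ^ n / s) * indicator {0<..} s) \<partial>lborel)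
      \<le> (\<integral>\<^sup>+s. indicator D (s *\<^sub>R x) * (ennreal (s ^ n / s) * indicator {0<..} s) \<partial>lborel)" .
  qed (use S D in simp_all)
  then have le: "emeasure (eucl_lborel n) S \<le> emeasure (eucl_lborel n) D" using S D by simp
  have "emeasure (eucl_lborel n) S = ennreal (vol n (eucl_ball n (r + e)) - vol n (eucl_ball n r))"
  proof -
    have "eucl_ball n r \<subseteq> eucl_ball n (r + e)" using e by (auto simp: eucl_ball_def)
    then have "emeasure (eucl_lborel n) S = emeasure (eucl_lborel n) (eucl_ball n (r + e)) - emeasure (eucl_lborel n) (eucl_ball n r)"
      unfolding S_def by (intro emeasure_Diff)
        (use r(1) in \<open>simp_all add: emeasure_eucl_lborel_eucl_ball borel_closed closed_eucl_ball\<close>)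
    then show ?thesis
      using r(1) e by (simp add: emeasure_eucl_lborel_eucl_ball vol_eucl_ball ennreal_minus)
  qed
  moreover have "emeasure (eucl_lborel n) D = ennreal (vol n (parallel_body n L e) - vol n L)"
  proof -
    have "emeasure (eucl_lborel n) D = emeasure (eucl_lborel n) (parallel_body n L e) - emeasure (eucl_lborel n) L"
      unfolding D_def by (intro emeasure_Diff)
        (simp_all add: emeasure_eucl_lborel_compact L compact_imp_borel cP subset_parallel_body)
    then show ?thesis
      by (simp add: emeasure_eucl_lborel_compact L cP pe ennreal_minus)
  qed
  moreover have "vol n L \<le> vol n (parallel_body n L e)"
    using emeasure_mono[OF subset_parallel_body[of L n e], where M = "eucl_lborel n"]
    by (simp add: emeasure_eucl_lborel_compact L cP pe compact_imp_borel)
  ultimately show ?thesis using le by (simp add: ennreal_le_iff)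
qed

lemma parallel_body_eucl_ball:
  assumes "r > 0" "e > 0" shows "parallel_body n (eucl_ball n r) e = eucl_ball n (r + e)"
proof
  show "parallel_body n (eucl_ball n r) e \<subseteq> eucl_ball n (r + e)"
  proof
    fix z assume "z \<in> parallel_body n (eucl_ball n r) e"
    then obtain x y where z: "z = x + e *\<^sub>R y" and x: "x \<in> eucl_ball n r" and y: "y \<in> eucl_ball n 1"
      unfolding parallel_body_def unit_ball_eq_eucl_ball by blast
    have "L2_set z {..<n} \<le> L2_set x {..<n} + L2_set (e *\<^sub>R y) {..<n}"
      unfolding z plus_fun_def by (rule L2_set_triangle_ineq)
    also have "\<dots> \<le> r + e * 1"
      unfolding L2_set_scaleR using x y assms(2) by (intro add_mono) (auto simp: eucl_ball_def)
    finally show "z \<in> eucl_ball n (r + e)"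
      using x y by (simp add: z eucl_ball_def in_eucl_iff scaleR_fun_def)
  qed
  show "eucl_ball n (r + e) \<subseteq> parallel_body n (eucl_ball n r) e"
  proof
    fix x assume x: "x \<in> eucl_ball n (r + e)"
    \<comment> \<open>The point is split in the proportion \<open>r : e\<close>; \<open>s\<close>
      normalizes the two weights to sum 1.\<close>
    define s where "s = 1 / (r + e)"
    have s: "r * s + e * s = 1" "s > 0" using assms by (simp_all add: s_def add_divide_distrib[symmetric])
    have xe: "u *\<^sub>R x \<in> eucl n" for u using x by (simp add: eucl_ball_def in_eucl_iff scaleR_fun_def)
    have nx: "L2_set x {..<n} * s \<le> 1" using x assms by (simp add: eucl_ball_def s_def divide_le_eq)
    have "x = (r * s) *\<^sub>R x + e *\<^sub>R (s *\<^sub>R x)" using s by (simp add: scaleR_add_left[symmetric])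
    moreover have "(r * s) *\<^sub>R x \<in> eucl_ball n r"
      using xe s assms mult_left_mono[OF nx, of r] by (simp add: eucl_ball_def L2_set_scaleR abs_mult ac_simps)
    moreover have "s *\<^sub>R x \<in> unit_ball n"
      using xe s nx by (simp add: unit_ball_def L2_set_scaleR ac_simps)
    ultimately show "x \<in> parallel_body n (eucl_ball n r) e" unfolding parallel_body_def by blast
  qed
qed

section \<open>Surface area of balls and of sets that contain them\<close>

lemma surface_area_eq_parallel_body:
  "surface_area n A = Liminf (at_right 0) (\<lambda>e. ereal ((vol n (parallel_body n A e) - vol n A) / e))"
  by (simp add: surface_area_def parallel_body_def)

lemma surface_area_eucl_ball:
  assumes "r > 0"
  shows "surface_area n (eucl_ball n r) = ereal (unit_ball_vol (real n) * (real n * r ^ (n - 1)))"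
proof -
  let ?V = "unit_ball_vol (real n)"
  have "((\<lambda>x. ?V * x ^ n) has_real_derivative ?V * (real n * r ^ (n - 1))) (at r)"
    by (auto intro!: derivative_eq_intros)
  then have "((\<lambda>e. (?V * (r + e) ^ n - ?V * r ^ n) / e) \<longlongrightarrow> ?V * (real n * r ^ (n - 1))) (at_right 0)"
    unfolding DERIV_def by (rule tendsto_within_subset) simp
  then have "((\<lambda>e. ereal ((?V * (r + e) ^ n - ?V * r ^ n) / e)) \<longlongrightarrow> ereal (?V * (real n * r ^ (n - 1)))) (at_right 0)"
    by (rule tendsto_ereal)
  moreover have "\<forall>\<^sub>F e in at_right 0. ereal ((?V * (r + e) ^ n - ?V * r ^ n) / e) =
      ereal ((vol n (parallel_body n (eucl_ball n r) e) - vol n (eucl_ball n r)) / e)"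
    using eventually_at_right_less[of 0]
    by eventually_elim (use assms in \<open>simp add: parallel_body_eucl_ball vol_eucl_ball\<close>)
  ultimately have "((\<lambda>e. ereal ((vol n (parallel_body n (eucl_ball n r) e) - vol n (eucl_ball n r)) / e))
      \<longlongrightarrow> ereal (?V * (real n * r ^ (n - 1)))) (at_right 0)"
    by (rule Lim_transform_eventually)
  then show ?thesis
    unfolding surface_area_eq_parallel_body by (rule lim_imp_Liminf[rotated]) simp
qed

lemma surface_area_ge_eucl_ball:
  assumes "compact L" "L \<subseteq> eucl n" "r > 0" "eucl_ball n r \<subseteq> L"
  shows "surface_area n (eucl_ball n r) \<le> surface_area n L"
  unfolding surface_area_eq_parallel_body
proof (rule Liminf_mono)
  show "\<forall>\<^sub>F e in at_right 0. ereal ((vol n (parallel_body n (eucl_ball n r) e) - vol n (eucl_ball n r)) / e)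
      \<le> ereal ((vol n (parallel_body n L e) - vol n L) / e)"
    using eventually_at_right_less[of 0]
  proof eventually_elim
    case (elim e)
    then show ?case
      using vol_parallel_body_diff_ge_ball[OF assms elim]
      by (simp add: parallel_body_eucl_ball[OF assms(3) elim] divide_right_mono)
  qed
qed

section \<open>The cylinder\<close>

definition cylinder :: "nat \<Rightarrow> real \<Rightarrow> (nat \<Rightarrow> real) set" where
  "cylinder m r = {x \<in> eucl (Suc m). L2_set x {..<m} \<le> r \<and> \<bar>x m\<bar> \<le> r}"

text \<open>The coefficients form a function instead of a matrix, which is how the Gram-Schmidt
  process below delivers them. Values are cut off to 0 from \<open>n\<close> on, so that they always
  lie in \<open>eucl n\<close>.\<close>

definition lin_map :: "nat \<Rightarrow> (nat \<Rightarrow> nat \<Rightarrow> real) \<Rightarrow> (nat \<Rightarrow> real) \<Rightarrow> nat \<Rightarrow> real" where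
  "lin_map n R x = (\<lambda>i. if i < n then \<Sum>j<n. R i j * x j else 0)"

lemma L2_set_Suc: "L2_set x {..<Suc m} = sqrt ((L2_set x {..<m})\<^sup>2 + (x m)\<^sup>2)"
  by (simp add: L2_set_def sum_nonneg)

lemma closed_cylinder: "closed (cylinder m r)"
proof -
  have "cylinder m r = eucl (Suc m) \<inter> ({x. L2_set x {..<m} \<le> r} \<inter> {x. \<bar>x m\<bar> \<le> r})"
    by (auto simp: cylinder_def)
  also have "closed \<dots>"
    by (intro closed_Int closed_eucl closed_L2_ball closed_Collect_le continuous_on_const
        continuous_on_rabs continuous_on_coord)
  finally show ?thesis .
qed

lemma cylinder_subset_eucl: "cylinder m r \<subseteq> eucl (Suc m)" by (auto simp: cylinder_def)

lemma compact_cylinder: "compact (cylinder m r)"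
proof -
  have "cylinder m r \<subseteq> eucl_ball (Suc m) (r + r)"
  proof
    fix x assume x: "x \<in> cylinder m r"
    have "L2_set x {..<Suc m} \<le> sqrt ((L2_set x {..<m})\<^sup>2) + sqrt ((x m)\<^sup>2)"
      unfolding L2_set_Suc by (rule sqrt_add_le_add_sqrt) simp_all
    also have "\<dots> \<le> r + r" using x by (simp add: cylinder_def)
    finally show "x \<in> eucl_ball (Suc m) (r + r)" using x by (simp add: eucl_ball_def cylinder_def)
  qed
  then have "cylinder m r = eucl_ball (Suc m) (r + r) \<inter> cylinder m r" by blast
  also have "compact \<dots>" by (rule compact_Int_closed[OF compact_eucl_ball closed_cylinder])
  finally show ?thesis .
qed

lemma L2_set_le_Suc: "L2_set x {..<m} \<le> L2_set x {..<Suc m}"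
  unfolding L2_set_Suc by (rule real_le_rsqrt) simp

lemma abs_le_L2_set_Suc: "\<bar>x m\<bar> \<le> L2_set x {..<Suc m}"
  unfolding L2_set_Suc by (rule real_le_rsqrt) simp

lemma eucl_ball_subset_cylinder: "eucl_ball (Suc m) r \<subseteq> cylinder m r"
proof
  fix x assume "x \<in> eucl_ball (Suc m) r"
  then show "x \<in> cylinder m r"
    using L2_set_le_Suc[of x m] abs_le_L2_set_Suc[of x m] by (simp add: eucl_ball_def cylinder_def)
qed

lemma convex_cylinder: "convex (cylinder m r)"
proof (rule convexI)
  fix x y :: "nat \<Rightarrow> real" and u v :: real
  assume x: "x \<in> cylinder m r" and y: "y \<in> cylinder m r" and uv: "u \<ge> 0" "v \<ge> 0" "u + v = 1"
  have comb: "u * a + v * b \<le> r" if "a \<le> r" "b \<le> r" for a b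
    using convex_bound_le[OF that uv] by simp
  have "L2_set (u *\<^sub>R x + v *\<^sub>R y) {..<m} \<le> L2_set (u *\<^sub>R x) {..<m} + L2_set (v *\<^sub>R y) {..<m}"
    unfolding plus_fun_def by (rule L2_set_triangle_ineq)
  also have "\<dots> = u * L2_set x {..<m} + v * L2_set y {..<m}" using uv by (simp add: L2_set_scaleR)
  also have "\<dots> \<le> r" using x y by (intro comb) (simp_all add: cylinder_def)
  finally have 1: "L2_set (u *\<^sub>R x + v *\<^sub>R y) {..<m} \<le> r" .
  have "\<bar>u * x m + v * y m\<bar> \<le> u * \<bar>x m\<bar> + v * \<bar>y m\<bar>"
    using uv abs_triangle_ineq[of "u * x m" "v * y m"] by (simp add: abs_mult)
  also have "\<dots> \<le> r" using x y by (intro comb) (simp_all add: cylinder_def)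
  finally show "u *\<^sub>R x + v *\<^sub>R y \<in> cylinder m r"
    using 1 x y by (simp add: cylinder_def in_eucl_iff scaleR_fun_def)
qed

lemma convex_body_cylinder:
  assumes "r > 0" shows "convex_body (Suc m) (cylinder m r)"
  unfolding convex_body_def
proof (intro conjI)
  show "compactin (Euclidean_space (Suc m)) (cylinder m r)"
    by (simp add: compactin_Euclidean_space_iff compact_cylinder cylinder_subset_eucl)
  define U where "U = {x :: nat \<Rightarrow> real. L2_set x {..<Suc m} < r}"
  have "open U" unfolding U_def by (intro open_Collect_less continuous_on_L2_set continuous_on_const)
  then have "openin (Euclidean_space (Suc m)) (U \<inter> eucl (Suc m))"
    unfolding Euclidean_space_def euclidean_product_topology
    by (simp add: openin_subtopology) blast
  moreover have "U \<inter> eucl (Suc m) \<subseteq> cylinder m r"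
    using eucl_ball_subset_cylinder[of m r] by (auto simp: U_def eucl_ball_def)
  ultimately have "U \<inter> eucl (Suc m) \<subseteq> Euclidean_space (Suc m) interior_of cylinder m r"
    by (rule interior_of_maximal[rotated])
  moreover have "0 \<in> U \<inter> eucl (Suc m)" using assms by (simp add: U_def L2_set_def in_eucl_iff)
  ultimately show "Euclidean_space (Suc m) interior_of cylinder m r \<noteq> {}" by blast
qed (rule convex_cylinder)

lemma unconditional_cylinder: "unconditional (Suc m) (cylinder m r)"
  unfolding unconditional_def
proof (intro allI impI)
  fix i assume i: "i < Suc m"
  have mem: "x(i := - x i) \<in> cylinder m r" if "x \<in> cylinder m r" for x
  proof -
    have "L2_set (x(i := - x i)) {..<m} = L2_set x {..<m}"
      unfolding L2_set_def by (intro arg_cong[where f = sqrt] sum.cong) auto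
    then show ?thesis using that i by (auto simp: cylinder_def in_eucl_iff)
  qed
  show "(\<lambda>x. x(i := - x i)) ` cylinder m r = cylinder m r"
  proof
    show "(\<lambda>x. x(i := - x i)) ` cylinder m r \<subseteq> cylinder m r" using mem by blast
    show "cylinder m r \<subseteq> (\<lambda>x. x(i := - x i)) ` cylinder m r"
    proof
      fix x assume "x \<in> cylinder m r"
      from mem[OF this] show "x \<in> (\<lambda>x. x(i := - x i)) ` cylinder m r"
        by (rule rev_image_eqI) (simp add: fun_eq_iff)
    qed
  qed
qed

section \<open>Slices orthogonal to the axis\<close>

lemma borel_fun_upd_vimage:
  assumes "A \<in> sets borel" shows "{x :: nat \<Rightarrow> real. x(m := t) \<in> A} \<in> sets borel"
proof -
  have "(\<lambda>x :: nat \<Rightarrow> real. x(m := t)) \<in> borel_measurable borel"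
    by (rule measurable_fun_upd_real[OF measurable_ident_sets[OF refl] borel_measurable_const])
  from measurable_sets[OF this assms] show ?thesis by (simp add: vimage_def)
qed

lemma emeasure_eucl_lborel_Suc:
  assumes A: "A \<in> sets borel"
  shows "emeasure (eucl_lborel (Suc m)) A = (\<integral>\<^sup>+t. emeasure (eucl_lborel m) {x. x(m := t) \<in> A} \<partial>lborel)"
proof -
  have "emeasure (eucl_lborel (Suc m)) A = (\<integral>\<^sup>+x. indicator A x \<partial>eucl_lborel (Suc m))" using A by simp
  also have "\<dots> = (\<integral>\<^sup>+t. \<integral>\<^sup>+x. indicator A (x(m := t)) \<partial>eucl_lborel m \<partial>lborel)"
    by (rule nn_integral_eucl_lborel_Suc) (use A in simp)
  also have "\<dots> = (\<integral>\<^sup>+t. emeasure (eucl_lborel m) {x. x(m := t) \<in> A} \<partial>lborel)"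
  proof (rule nn_integral_cong)
    fix t
    have "(\<lambda>x. indicator A (x(m := t)) :: ennreal) = indicator {x. x(m := t) \<in> A}"
      by (simp add: fun_eq_iff indicator_def)
    then show "(\<integral>\<^sup>+x. indicator A (x(m := t)) \<partial>eucl_lborel m) = emeasure (eucl_lborel m) {x. x(m := t) \<in> A}"
      using borel_fun_upd_vimage[OF A] by simp
  qed
  finally show ?thesis .
qed

lemma vol_cylinder:
  assumes r: "r > 0"
  shows "vol (Suc m) (cylinder m r) = 2 * r * (unit_ball_vol (real m) * r ^ m)"
proof -
  let ?c = "unit_ball_vol (real m) * r ^ m"
  have b: "cylinder m r \<in> sets borel" by (rule borel_closed[OF closed_cylinder])
  have "emeasure (eucl_lborel (Suc m)) (cylinder m r) = (\<integral>\<^sup>+t. ennreal ?c * indicator {-r..r} t \<partial>lborel)"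
    unfolding emeasure_eucl_lborel_Suc[OF b]
  proof (rule nn_integral_cong)
    fix t :: real
    have "emeasure (eucl_lborel m) {x. x(m := t) \<in> cylinder m r} =
        emeasure (eucl_lborel m) (if t \<in> {-r..r} then eucl_ball m r else {})"
    proof (rule emeasure_eq_AE[OF AE_mp[OF AE_eucl_lborel_eucl AE_I2]], rule impI)
      fix x assume x: "x \<in> eucl m"
      have "L2_set (x(m := t)) {..<m} = L2_set x {..<m}" by (rule L2_set_cong) auto
      then show "(x \<in> {x. x(m := t) \<in> cylinder m r}) = (x \<in> (if t \<in> {-r..r} then eucl_ball m r else {}))"
        using x by (auto simp: cylinder_def eucl_ball_def in_eucl_iff)
    qed (simp_all add: borel_fun_upd_vimage b borel_closed closed_eucl_ball)
    then show "emeasure (eucl_lborel m) {x. x(m := t) \<in> cylinder m r} = ennreal ?c * indicator {-r..r} t"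
      using r by (simp add: emeasure_eucl_lborel_eucl_ball)
  qed
  also have "\<dots> = ennreal ?c * emeasure lborel {-r..r}" by (simp add: nn_integral_cmult_indicator)
  also have "\<dots> = ennreal (2 * r * ?c)"
    using r by (simp add: ennreal_mult[symmetric] mult.commute)
  finally have "ennreal (vol (Suc m) (cylinder m r)) = ennreal (2 * r * ?c)"
    by (simp add: emeasure_eucl_lborel_compact[OF compact_cylinder cylinder_subset_eucl])
  then show ?thesis using r by (subst (asm) ennreal_inj) simp_all
qed

text \<open>The bound on the parallel volume is a polynomial in \<open>e\<close> with value
  \<open>vol n K\<close> at 0, so the surface area is at most its derivative there.\<close>

lemma surface_area_le_circumscribed:
  assumes K: "compact K" "K \<subseteq> eucl n" "convex K" and r: "r > 0" "eucl_ball n r \<subseteq> K"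
  shows "surface_area n K \<le> ereal (real n / r * vol n K)"
proof -
  have bound: "vol n (parallel_body n K e) \<le> (1 + e / r) ^ n * vol n K" if e: "e > 0" for e
  proof -
    define s where "s = 1 / (1 + e / r)"
    have er: "1 + e / r > 0" using e r(1) by (intro add_pos_pos) simp_all
    then have s: "s > 0" by (simp add: s_def)
    have cP: "compact (parallel_body n K e)" by (rule compact_parallel_body[OF K(1)])
    \<comment> \<open>Instead of enlarging \<open>K\<close>, the parallel body is shrunk by
      \<open>s\<close>: as \<open>r *\<^sub>R y\<close> lies in \<open>K\<close>, the shrunk point
      is a convex combination with weights \<open>s\<close> and \<open>s * (e / r)\<close>. The
      expression \<open>if i = i\<close> is the diagonal of the scaling coefficients as the
      triangular lemma produces it.\<close>
    have "ennreal (\<Prod>i<n. if i = i then s else 0) * emeasure (eucl_lborel n) (parallel_body n K e)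
        \<le> emeasure (eucl_lborel n) K"
    proof (rule emeasure_eucl_lborel_triangular_le[where v = "\<lambda>_. 0" and R = "\<lambda>i j. if i = j then s else 0"])
      fix z assume z: "z \<in> parallel_body n K e" "z \<in> eucl n"
      have eq: "(\<lambda>i. if i < n then (\<Sum>j<n. (if i = j then s else 0) * z j) + 0 else 0) = s *\<^sub>R z"
        using z(2) by (auto simp: fun_eq_iff scaleR_fun_def in_eucl_iff if_distrib[of "\<lambda>a. a * _"] cong: if_cong)
      obtain x y where xy: "z = x + e *\<^sub>R y" "x \<in> K" "y \<in> eucl_ball n 1"
        using z(1) unfolding parallel_body_def unit_ball_eq_eucl_ball by blast
      have "r *\<^sub>R y \<in> eucl n" using xy(3) by (simp add: eucl_ball_def in_eucl_iff scaleR_fun_def)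
      then have "r *\<^sub>R y \<in> eucl_ball n r"
        using xy(3) r(1) by (simp add: eucl_ball_def L2_set_scaleR)
      then have ry: "r *\<^sub>R y \<in> K" using r(2) by blast
      have sum: "s + s * (e / r) = 1" unfolding s_def using er
        by (metis add_divide_distrib divide_self less_irrefl times_divide_eq_left mult_1)
      have "0 \<le> s * (e / r)" using s e r(1) by simp
      then have "s *\<^sub>R x + (s * (e / r)) *\<^sub>R (r *\<^sub>R y) \<in> K"
        by (rule convexD[OF K(3) xy(2) ry less_imp_le[OF s] _ sum])
      moreover have "s *\<^sub>R x + (s * (e / r)) *\<^sub>R (r *\<^sub>R y) = s *\<^sub>R z"
        using r(1) by (simp add: xy(1) scaleR_add_right)
      ultimately show "(\<lambda>i. if i < n then (\<Sum>j<n. (if i = j then s else 0) * z j) + 0 else 0) \<in> K"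
        by (simp only: eq)
    qed (use K cP s in \<open>auto intro: compact_imp_borel\<close>)
    then have "ennreal (s ^ n * vol n (parallel_body n K e)) \<le> ennreal (vol n K)"
      using s by (simp add: emeasure_eucl_lborel_compact K cP parallel_body_subset_eucl ennreal_mult)
    then have "s ^ n * vol n (parallel_body n K e) \<le> vol n K"
      by (subst (asm) ennreal_le_iff) simp_all
    then show ?thesis
      using er by (simp add: s_def power_one_over pos_divide_le_eq mult.commute)
  qed
  have "((\<lambda>x. (1 + x / r) ^ n * vol n K) has_real_derivative real n / r * vol n K) (at 0)"
    using r(1) by (auto intro!: derivative_eq_intros)
  \<comment> \<open>The terms \<open>0 + e\<close> and \<open>0 / r\<close> keep the shape of the
    difference quotient in \<open>DERIV_def\<close>.\<close>
  then have "((\<lambda>e. ((1 + (0 + e) / r) ^ n * vol n K - (1 + 0 / r) ^ n * vol n K) / e)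
      \<longlongrightarrow> real n / r * vol n K) (at_right 0)"
    unfolding DERIV_def by (rule tendsto_within_subset) simp
  then have "((\<lambda>e. ereal (((1 + (0 + e) / r) ^ n * vol n K - (1 + 0 / r) ^ n * vol n K) / e))
      \<longlongrightarrow> ereal (real n / r * vol n K)) (at_right 0)"
    by (rule tendsto_ereal)
  from lim_imp_Liminf[OF _ this]
  have lim: "Liminf (at_right 0) (\<lambda>e. ereal (((1 + (0 + e) / r) ^ n * vol n K - (1 + 0 / r) ^ n * vol n K) / e))
      = ereal (real n / r * vol n K)" by simp
  show ?thesis
    unfolding surface_area_eq_parallel_body lim[symmetric]
  proof (rule Liminf_mono)
    show "\<forall>\<^sub>F e in at_right 0. ereal ((vol n (parallel_body n K e) - vol n K) / e)
      \<le> ereal (((1 + (0 + e) / r) ^ n * vol n K - (1 + 0 / r) ^ n * vol n K) / e)"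
      using eventually_at_right_less[of 0]
      by eventually_elim (simp add: bound divide_right_mono)
  qed
qed

text \<open>The left side is the expansion of the product in \<open>c\<close> up to first order; the
  omitted terms are nonnegative. The product arises as the determinant of a triangular matrix to
  which \<open>c\<close> times the identity is added.\<close>

lemma prod_add_ge_weierstrass:
  fixes a b :: "nat \<Rightarrow> real"
  assumes "\<And>i. i < n \<Longrightarrow> a i > 0" "c \<ge> 0"
  shows "(\<Prod>i<n. a i) * (1 + c * (\<Sum>i<n. 1 / a i)) \<le> (\<Prod>i<n. a i + c)"
  using assms(1)
proof (induction n)
  case (Suc n)
  let ?P = "\<Prod>i<n. a i" and ?S = "\<Sum>i<n. 1 / a i"
  have a: "a n > 0" and P: "?P \<ge> 0" using Suc.prems by (auto intro!: prod_nonneg intro: less_imp_le)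
  have S: "?S \<ge> 0" using Suc.prems by (intro sum_nonneg) (simp add: less_imp_le)
  have "?P * a n * (1 + c * (?S + 1 / a n)) = ?P * (1 + c * ?S) * (a n + c) - ?P * c * (c * ?S)"
    using a by (simp add: field_simps)
  also have "\<dots> \<le> ?P * (1 + c * ?S) * (a n + c)"
    using P S assms(2) by simp
  also have "\<dots> \<le> (\<Prod>i<n. a i + c) * (a n + c)"
  proof (rule mult_right_mono)
    show "?P * (1 + c * ?S) \<le> (\<Prod>i<n. a i + c)" using Suc by simp
    show "0 \<le> a n + c" using a assms(2) by linarith
  qed
  finally show ?case by simp
qed simp

text \<open>The inequality of the means in logarithmic form: the numbers \<open>ln (1 / a i)\<close>
  sum to 0, and each is at most \<open>1 / a i - 1\<close>.\<close>

lemma sum_inverse_ge_card: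
  fixes a :: "nat \<Rightarrow> real"
  assumes pos: "\<And>i. i < n \<Longrightarrow> a i > 0" and P: "(\<Prod>i<n. a i) = 1"
  shows "real n \<le> (\<Sum>i<n. 1 / a i)"
proof -
  have nz: "a i \<noteq> 0" if "i < n" for i using pos[OF that] by simp
  have "0 = ln (\<Prod>i<n. 1 / a i)" using P by (simp add: prod_dividef)
  also have "\<dots> = (\<Sum>i<n. ln (1 / a i))" by (subst ln_prod) (simp_all add: pos nz)
  also have "\<dots> \<le> (\<Sum>i<n. 1 / a i - 1)" using pos by (intro sum_mono ln_le_minus_one) simp
  finally show ?thesis by (simp add: sum_subtractf)
qed

lemma continuous_on_lin_map: "continuous_on S (lin_map n R)"
proof (rule continuous_on_coordinatewise_then_product)
  fix i show "continuous_on S (\<lambda>x. lin_map n R x i)"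
    unfolding lin_map_def
    by (cases "i < n") (simp_all add: continuous_on_sum continuous_on_mult_left continuous_on_coord)
qed

lemma lin_map_in_eucl: "lin_map n R x \<in> eucl n"
  by (simp add: lin_map_def in_eucl_iff)

text \<open>The slice of the parallel body at a height attained on the image contains \<open>(R' + e/r) B\<close>,
  which accounts for the lateral boundary; the slices beyond contain a translate of \<open>R' B\<close>.\<close>

lemma vol_parallel_body_triangular_cylinder_ge:
  assumes tri: "\<And>i j. j < i \<Longrightarrow> R i j = 0" and pos: "\<And>i. i < Suc m \<Longrightarrow> R i i > (0::real)"
    and det: "(\<Prod>i<Suc m. R i i) = 1" and r: "r > 0" and e: "e > 0"
  shows "vol (Suc m) (cylinder m r) * (1 + real (Suc m) * e / r)
    \<le> vol (Suc m) (parallel_body (Suc m) (lin_map (Suc m) R ` cylinder m r) e)"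
proof -
  let ?A = "parallel_body (Suc m) (lin_map (Suc m) R ` cylinder m r) e"
  define c where "c = unit_ball_vol (real m) * r ^ m"
  define a where "a = R m m * r"
  define P1 where "P1 = (\<Prod>i<m. R i i + e / r)"
  define P0 where "P0 = (\<Prod>i<m. R i i)"
  have Rm: "R m m > 0" using pos by simp
  have a: "a > 0" using Rm r by (simp add: a_def)
  have er: "e / r > 0" using e r by simp
  have P0: "P0 > 0" unfolding P0_def using pos by (intro prod_pos) auto
  have P1: "P1 > 0" unfolding P1_def using pos er by (intro prod_pos ballI add_pos_pos) auto
  have c: "c > 0" using r by (simp add: c_def)
  have cA: "compact ?A"
    by (intro compact_parallel_body compact_continuous_image continuous_on_lin_map compact_cylinder)
  have eA: "?A \<subseteq> eucl (Suc m)"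
    by (intro parallel_body_subset_eucl) (auto simp: lin_map_in_eucl)
  have bA: "?A \<in> sets borel" by (rule compact_imp_borel[OF cA])
  have inA: "z \<in> ?A" if "x \<in> cylinder m r" "y \<in> unit_ball (Suc m)" "z = lin_map (Suc m) R x + e *\<^sub>R y" for x y z
    using that unfolding parallel_body_def by blast
  have upd: "L2_set (x(m := t)) {..<m} = L2_set x {..<m}" for x :: "nat \<Rightarrow> real" and t
    by (rule L2_set_cong) auto
  have lin_m: "lin_map (Suc m) R x m = R m m * x m" for x
  proof -
    have "(\<Sum>j<m. R m j * x j) = 0" by (rule sum.neutral) (simp add: tri)
    then show ?thesis by (simp add: lin_map_def)
  qed
  have inner: "ennreal P1 * ennreal c \<le> emeasure (eucl_lborel m) {x. x(m := z) \<in> ?A}" if z: "\<bar>z\<bar> \<le> a" for z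
  proof -
    \<comment> \<open>The last row of \<open>R\<close> has only its diagonal entry, so the image
      reaches height \<open>z\<close> exactly from height \<open>t\<close> of the cylinder.\<close>
    define t where "t = z / R m m"
    have t: "\<bar>t\<bar> \<le> r" "R m m * t = z"
      using z Rm by (simp_all add: t_def a_def abs_divide pos_divide_le_eq mult.commute)
    \<comment> \<open>A point over \<open>x\<close> at height \<open>t\<close> is moved by
      \<open>e\<close> times the vector \<open>x / r\<close> of the unit ball. On the base this adds
      \<open>e / r\<close> to the diagonal; the last column of \<open>R\<close> contributes the
      translation \<open>R i m * t\<close>.\<close>
    let ?R = "\<lambda>i j. R i j + (if i = j then e / r else 0)"
    have "ennreal (\<Prod>i<m. ?R i i) * emeasure (eucl_lborel m) (eucl_ball m r) \<le> emeasure (eucl_lborel m) {x. x(m := z) \<in> ?A}"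
    proof (rule emeasure_eucl_lborel_triangular_le[where R = ?R and v = "\<lambda>i. R i m * t"])
      fix x assume x: "x \<in> eucl_ball m r" "x \<in> eucl m"
      let ?w = "\<lambda>i. if i < m then (\<Sum>j<m. ?R i j * x j) + R i m * t else 0"
      have "?w(m := z) \<in> ?A"
      proof (rule inA)
        show "x(m := t) \<in> cylinder m r"
          using x t by (auto simp: cylinder_def eucl_ball_def upd in_eucl_iff)
        have "x \<in> eucl (Suc m)" and "x m = 0" using x(2) by (simp_all add: in_eucl_iff)
        moreover have "(L2_set x {..<m} / r)\<^sup>2 \<le> 1"
          using x(1) r by (intro power_le_one) (simp_all add: eucl_ball_def)
        ultimately show "(1 / r) *\<^sub>R x \<in> unit_ball (Suc m)"
          using r by (simp add: unit_ball_def L2_set_scaleR L2_set_Suc)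
            (simp add: in_eucl_iff scaleR_fun_def)
        show "?w(m := z) = lin_map (Suc m) R (x(m := t)) + e *\<^sub>R (1 / r) *\<^sub>R x"
        proof
          fix i
          consider "i < m" | "i = m" | "i > m" by linarith
          then show "(?w(m := z)) i = (lin_map (Suc m) R (x(m := t)) + e *\<^sub>R (1 / r) *\<^sub>R x) i"
          proof cases
            case 1
            have "(\<Sum>j<m. ?R i j * x j) = (\<Sum>j<m. R i j * x j) + (\<Sum>j<m. if i = j then e / r * x j else 0)"
              unfolding sum.distrib[symmetric] by (rule sum.cong) (auto simp: algebra_simps)
            also have "(\<Sum>j<m. if i = j then e / r * x j else 0) = e / r * x i" using 1 by simp
            finally show ?thesis using 1 by (simp add: lin_map_def scaleR_fun_def)
          next
            case 2
            then show ?thesis using \<open>x m = 0\<close> t(2) lin_m[of "x(m := t)"] by (simp add: scaleR_fun_def)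
          next
            case 3
            then show ?thesis using x(2) by (simp add: lin_map_def scaleR_fun_def in_eucl_iff)
          qed
        qed
      qed
      then show "?w \<in> {x. x(m := z) \<in> ?A}" unfolding mem_Collect_eq .
    qed (use tri pos er in \<open>simp_all add: borel_closed closed_eucl_ball borel_fun_upd_vimage bA add_pos_pos\<close>)
    then show ?thesis using r by (simp add: emeasure_eucl_lborel_eucl_ball c_def P1_def)
  qed
  have outer: "ennreal P0 * ennreal c \<le> emeasure (eucl_lborel m) {x. x(m := z) \<in> ?A}"
    if z: "a < \<bar>z\<bar>" "\<bar>z\<bar> \<le> a + e" for z
  proof -
    \<comment> \<open>Beyond the image the slices start from the top or the bottom base of the
      cylinder, and the remaining height is covered by a multiple of the axis vector.\<close>
    define t where "t = sgn z * r"
    have t: "\<bar>t\<bar> \<le> r" "\<bar>z - R m m * t\<bar> \<le> e"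
      using z a r by (auto simp: t_def a_def sgn_if abs_if split: if_splits)
    have "ennreal (\<Prod>i<m. R i i) * emeasure (eucl_lborel m) (eucl_ball m r) \<le> emeasure (eucl_lborel m) {x. x(m := z) \<in> ?A}"
    proof (rule emeasure_eucl_lborel_triangular_le[where R = R and v = "\<lambda>i. R i m * t"])
      fix x assume x: "x \<in> eucl_ball m r" "x \<in> eucl m"
      let ?w = "\<lambda>i. if i < m then (\<Sum>j<m. R i j * x j) + R i m * t else 0"
      let ?y = "\<lambda>i. if i = m then (z - R m m * t) / e else 0"
      have "?w(m := z) \<in> ?A"
      proof (rule inA)
        show "x(m := t) \<in> cylinder m r"
          using x t by (auto simp: cylinder_def eucl_ball_def upd in_eucl_iff)
        have "L2_set ?y {..<m} = 0" by (simp add: L2_set_def)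
        then show "?y \<in> unit_ball (Suc m)"
          using t(2) e by (simp add: unit_ball_def L2_set_Suc in_eucl_iff abs_divide abs_square_le_1)
        show "?w(m := z) = lin_map (Suc m) R (x(m := t)) + e *\<^sub>R ?y"
        proof
          fix i
          consider "i < m" | "i = m" | "i > m" by linarith
          then show "(?w(m := z)) i = (lin_map (Suc m) R (x(m := t)) + e *\<^sub>R ?y) i"
          proof cases
            case 1
            then show ?thesis by (simp add: lin_map_def scaleR_fun_def)
          next
            case 2
            then show ?thesis using e lin_m[of "x(m := t)"] by (simp add: scaleR_fun_def)
          next
            case 3
            then show ?thesis by (simp add: lin_map_def scaleR_fun_def)
          qed
        qed
      qed
      then show "?w \<in> {x. x(m := z) \<in> ?A}" unfolding mem_Collect_eq .
    qed (use tri pos in \<open>simp_all add: borel_closed closed_eucl_ball borel_fun_upd_vimage bA\<close>)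
    then show ?thesis using r by (simp add: emeasure_eucl_lborel_eucl_ball c_def P0_def)
  qed
  \<comment> \<open>The inner slices occupy heights of total length \<open>2 * a\<close>, the two
    caps have length \<open>e\<close> each. Half-open intervals keep the three ranges disjoint, so
    at most one summand is nonzero at each height.\<close>
  have "ennreal (P1 * c * (2 * a) + P0 * c * e + P0 * c * e) =
      ennreal (P1 * c) * ennreal (2 * a) + ennreal (P0 * c) * ennreal e + ennreal (P0 * c) * ennreal e"
    using P0 P1 c a e by (simp add: ennreal_mult[symmetric] ennreal_plus[symmetric] del: ennreal_plus)
  also have "\<dots> = (\<integral>\<^sup>+z. ennreal (P1 * c) * indicator {-a..a} z + ennreal (P0 * c) * indicator {a<..a + e} z
      + ennreal (P0 * c) * indicator {-a - e..<-a} z \<partial>lborel)"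
    using a e by (simp add: nn_integral_add nn_integral_cmult_indicator)
  also have "\<dots> \<le> (\<integral>\<^sup>+z. emeasure (eucl_lborel m) {x. x(m := z) \<in> ?A} \<partial>lborel)"
  proof (rule nn_integral_mono)
    fix z :: real
    consider "\<bar>z\<bar> \<le> a" | "a < z" "z \<le> a + e" | "-a - e \<le> z" "z < -a" | "\<bar>z\<bar> > a + e" by linarith
    then show "ennreal (P1 * c) * indicator {-a..a} z + ennreal (P0 * c) * indicator {a<..a + e} z
      + ennreal (P0 * c) * indicator {-a - e..<-a} z \<le> emeasure (eucl_lborel m) {x. x(m := z) \<in> ?A}"
    proof cases
      case 1
      then show ?thesis using inner[of z] P1 c by (auto simp: ennreal_mult indicator_def abs_le_iff)
    next
      case 2
      then show ?thesis using outer[of z] a P0 c by (auto simp: ennreal_mult indicator_def)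
    next
      case 3
      then show ?thesis using outer[of z] a P0 c by (auto simp: ennreal_mult indicator_def)
    next
      case 4
      then show ?thesis using a e by (auto simp: indicator_def)
    qed
  qed
  also have "\<dots> = ennreal (vol (Suc m) ?A)"
    unfolding emeasure_eucl_lborel_Suc[OF bA, symmetric] by (rule emeasure_eucl_lborel_compact[OF cA eA])
  finally have "P1 * c * (2 * a) + P0 * c * e + P0 * c * e \<le> vol (Suc m) ?A"
    by (subst (asm) ennreal_le_iff) simp_all
  moreover have "vol (Suc m) (cylinder m r) * (1 + real (Suc m) * e / r)
      \<le> P1 * c * (2 * a) + P0 * c * e + P0 * c * e"
  proof -
    have PR: "P0 * R m m = 1" using det by (simp add: P0_def)
    have "real (Suc m) \<le> (\<Sum>i<m. 1 / R i i) + 1 / R m m"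
      using sum_inverse_ge_card[OF pos det] by simp
    \<comment> \<open>By determinant 1 the caps contribute exactly the last reciprocal, the one that
      the lateral bound does not produce.\<close>
    also have "1 / R m m = P0" using PR Rm by (simp add: field_simps)
    finally have "e / r * real (Suc m) \<le> e / r * ((\<Sum>i<m. 1 / R i i) + P0)"
      using er by (intro mult_left_mono) simp_all
    then have "1 + real (Suc m) * e / r \<le> 1 + e / r * (\<Sum>i<m. 1 / R i i) + e / r * P0"
      unfolding distrib_left times_divide_eq_left[symmetric] mult.commute[of "real (Suc m)"] by linarith
    also have "1 + e / r * (\<Sum>i<m. 1 / R i i) \<le> R m m * P1"
    proof -
      have "P0 * (1 + e / r * (\<Sum>i<m. 1 / R i i)) \<le> P1"
        unfolding P0_def P1_def using pos er by (intro prod_add_ge_weierstrass) auto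
      from mult_left_mono[OF this, of "R m m"] Rm have
        "(P0 * R m m) * (1 + e / r * (\<Sum>i<m. 1 / R i i)) \<le> R m m * P1" by (simp add: ac_simps)
      then show ?thesis by (simp add: PR)
    qed
    finally have "2 * r * c * (1 + real (Suc m) * e / r) \<le> 2 * r * c * (R m m * P1 + e / r * P0)"
      using r c by (intro mult_left_mono) simp_all
    also have "\<dots> = P1 * c * (2 * a) + P0 * c * e + P0 * c * e"
      using r by (simp add: a_def field_simps)
    finally show ?thesis by (simp only: vol_cylinder[OF r] c_def)
  qed
  ultimately show ?thesis by linarith
qed

text \<open>Allowing \<open>V\<close> to exceed the volume of \<open>A\<close> means that, for a
  linear image of the cylinder, an upper bound on the volume is enough.\<close>

lemma surface_area_ge_linear:
  assumes V: "vol n A \<le> V" and "\<And>e. e > 0 \<Longrightarrow> V * (1 + c * e) \<le> vol n (parallel_body n A e)"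
  shows "ereal (c * V) \<le> surface_area n A"
  unfolding surface_area_eq_parallel_body
proof (rule Liminf_bounded)
  show "\<forall>\<^sub>F e in at_right 0. ereal (c * V) \<le> ereal ((vol n (parallel_body n A e) - vol n A) / e)"
    using eventually_at_right_less[of 0]
  proof eventually_elim
    case (elim e)
    then show ?case using V assms(2)[OF elim] by (simp add: pos_le_divide_eq algebra_simps)
  qed
qed

lemma lin_map_id: "x \<in> eucl n \<Longrightarrow> lin_map n (\<lambda>i j. if i = j then 1 else 0) x = x"
  by (auto simp: lin_map_def in_eucl_iff fun_eq_iff if_distrib[of "\<lambda>a. a * _"] cong: if_cong)

text \<open>The bound for circumscribed bodies meets the slicing bound with \<open>R\<close> the
  identity, where the inequality of the means is an equality.\<close>

lemma surface_area_cylinder: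
  assumes r: "r > 0"
  shows "surface_area (Suc m) (cylinder m r) = ereal (real (Suc m) / r * vol (Suc m) (cylinder m r))"
proof (rule antisym)
  show "surface_area (Suc m) (cylinder m r) \<le> ereal (real (Suc m) / r * vol (Suc m) (cylinder m r))"
    by (rule surface_area_le_circumscribed[OF compact_cylinder cylinder_subset_eucl convex_cylinder r eucl_ball_subset_cylinder])
  have id: "lin_map (Suc m) (\<lambda>i j. if i = j then 1 else 0) ` cylinder m r = cylinder m r"
    using cylinder_subset_eucl[of m r] by (force simp: lin_map_id)
  show "ereal (real (Suc m) / r * vol (Suc m) (cylinder m r)) \<le> surface_area (Suc m) (cylinder m r)"
  proof (rule surface_area_ge_linear[OF order_refl])
    fix e :: real assume "e > 0"
    from vol_parallel_body_triangular_cylinder_ge[OF _ _ _ r this, of "\<lambda>i j. if i = j then 1 else 0" m]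
    show "vol (Suc m) (cylinder m r) * (1 + real (Suc m) / r * e) \<le> vol (Suc m) (parallel_body (Suc m) (cylinder m r) e)"
      by (simp add: id)
  qed
qed

section \<open>Minimality of the surface area\<close>

lemma dot_commute: "dot n x y = dot n y x"
  by (simp add: dot_def mult.commute)

text \<open>The coefficients \<open>C\<close> only carry the independence of the \<open>t j\<close> over to the next step.\<close>

lemma gram_schmidt_triangular:
  fixes t :: "nat \<Rightarrow> nat \<Rightarrow> real"
  assumes indep: "\<forall>c. (\<forall>k<n. (\<Sum>j<n. c j * t j k) = 0) \<longrightarrow> (\<forall>j<n. c j = 0)"
  assumes "p \<le> n"
  shows "\<exists>q R C. (\<forall>i<p. \<forall>j<p. dot n (q i) (q j) = (if i = j then 1 else 0)) \<and>
    (\<forall>j<p. \<forall>k<n. t j k = (\<Sum>i<p. R i j * q i k)) \<and> (\<forall>i j. j < i \<longrightarrow> R i j = 0) \<and>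
    (\<forall>j<p. R j j > (0::real)) \<and> (\<forall>i<p. \<forall>k<n. q i k = (\<Sum>j<p. C i j * t j k))"
  using \<open>p \<le> n\<close>
proof (induction p)
  case 0
  show ?case by (intro exI[of _ "\<lambda>_ _. 0"]) simp
next
  case (Suc p)
  then have p: "p < n" by simp
  from Suc.IH[OF less_imp_le[OF p]] obtain q R C
    where IH: "\<forall>i<p. \<forall>j<p. dot n (q i) (q j) = (if i = j then 1 else 0)"
      "\<forall>j<p. \<forall>k<n. t j k = (\<Sum>i<p. R i j * q i k)" "\<forall>i j. j < i \<longrightarrow> R i j = 0"
      "\<forall>j<p. R j j > 0" "\<forall>i<p. \<forall>k<n. q i k = (\<Sum>j<p. C i j * t j k)"
    by (elim exE conjE) (rule that)
  have orth: "dot n (q i) (q j) = (if i = j then 1 else 0)" if "i < p" "j < p" for i j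
    using IH(1) that by blast
  have dec: "t j k = (\<Sum>i<p. R i j * q i k)" if "j < p" "k < n" for j k
    using IH(2) that by blast
  have tri: "R i j = 0" if "j < i" for i j using IH(3) that by blast
  have pos: "R j j > 0" if "j < p" for j using IH(4) that by blast
  have inv: "q i k = (\<Sum>j<p. C i j * t j k)" if "i < p" "k < n" for i k
    using IH(5) that by blast
  define d where "d i = dot n (t p) (q i)" for i
  define u where "u k = t p k - (\<Sum>i<p. d i * q i k)" for k
  define b where "b j = (\<Sum>i<p. d i * C i j)" for j
  have comb: "(\<Sum>i<p. d i * q i k) = (\<Sum>j<p. b j * t j k)" if "k < n" for k
  proof -
    have "(\<Sum>i<p. d i * q i k) = (\<Sum>i<p. \<Sum>j<p. d i * C i j * t j k)"
      using that by (intro sum.cong) (simp_all add: inv sum_distrib_left mult.assoc)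
    also have "\<dots> = (\<Sum>j<p. b j * t j k)"
      unfolding b_def sum_distrib_right by (rule sum.swap)
    finally show ?thesis .
  qed
  have orth_u: "dot n u (q i) = 0" if i: "i < p" for i
  proof -
    have "dot n u (q i) = d i - (\<Sum>k<n. \<Sum>l<p. d l * q l k * q i k)"
      by (simp add: dot_def u_def d_def left_diff_distrib sum_subtractf sum_distrib_right)
    also have "(\<Sum>k<n. \<Sum>l<p. d l * q l k * q i k) = (\<Sum>l<p. d l * dot n (q l) (q i))"
      unfolding dot_def sum_distrib_left mult.assoc by (rule sum.swap)
    also have "\<dots> = (\<Sum>l<p. if l = i then d l else 0)"
      by (rule sum.cong) (use i in \<open>auto simp: orth\<close>)
    also have "\<dots> = d i" using i by simp
    finally show ?thesis by simp
  qed
  have "dot n u u \<noteq> 0"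
  proof
    assume "dot n u u = 0"
    then have "\<forall>k\<in>{..<n}. u k * u k = 0"
      unfolding dot_def by (subst (asm) sum_nonneg_eq_0_iff) simp_all
    then have u0: "u k = 0" if "k < n" for k using that by simp
    \<comment> \<open>A vanishing remainder would give a linear relation among the
      \<open>t j\<close> whose coefficient at \<open>p\<close> is \<open>-1\<close>.\<close>
    define c where "c j = (if j < p then b j else if j = p then -1 else 0)" for j
    have split: "{..<n} = {..<p} \<union> ({p} \<union> {p<..<n})" using p by auto
    have "(\<Sum>j<n. c j * t j k) = 0" if k: "k < n" for k
    proof -
      have "(\<Sum>j<n. c j * t j k) = (\<Sum>j<p. c j * t j k) + (\<Sum>j\<in>{p} \<union> {p<..<n}. c j * t j k)"
        unfolding split by (rule sum.union_disjoint) auto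
      also have "(\<Sum>j<p. c j * t j k) = (\<Sum>j<p. b j * t j k)" by (rule sum.cong) (auto simp: c_def)
      also have "(\<Sum>j\<in>{p} \<union> {p<..<n}. c j * t j k) = - t p k" by (simp add: c_def)
      finally show ?thesis using u0[OF k] comb[OF k] by (simp add: u_def)
    qed
    then have "c p = 0" using p indep by blast
    then show False by (simp add: c_def)
  qed
  moreover have "dot n u u \<ge> 0" unfolding dot_def by (intro sum_nonneg) simp
  ultimately have upos: "dot n u u > 0" by simp
  define \<nu> where "\<nu> = sqrt (dot n u u)"
  have \<nu>: "\<nu> > 0" "\<nu> * \<nu> = dot n u u" using upos by (simp_all add: \<nu>_def)
  define q' where "q' i = (if i < p then q i else (\<lambda>k. u k / \<nu>))" for i
  \<comment> \<open>The new column consists of the projection coefficients, with the length of the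
    remainder on the diagonal; this is the source of the positive diagonal.\<close>
  define R' where "R' i j = (if j < p then R i j else if j = p then (if i < p then d i else if i = p then \<nu> else 0) else 0)" for i j
  define C' where "C' i j = (if i < p then (if j < p then C i j else 0) else if j < p then - b j / \<nu> else 1 / \<nu>)" for i j
  have du: "dot n (\<lambda>k. u k / \<nu>) y = dot n u y / \<nu>" for y
    by (simp add: dot_def sum_divide_distrib)
  have ud: "dot n y (\<lambda>k. u k / \<nu>) = dot n y u / \<nu>" for y
    by (simp add: dot_def sum_divide_distrib)
  have r1: "dot n (q' i) (q' j) = (if i = j then 1 else 0)" if "i < Suc p" "j < Suc p" for i j
    using that \<nu> by (auto simp: q'_def orth du ud orth_u dot_commute[of n "q _" u])
  have r2: "t j k = (\<Sum>i<Suc p. R' i j * q' i k)" if "j < Suc p" "k < n" for j k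
  proof (cases "j < p")
    case True
    then show ?thesis using that by (simp add: R'_def q'_def dec tri)
  next
    case False
    then have "j = p" using that(1) by simp
    then show ?thesis using \<nu>(1) by (simp add: R'_def q'_def u_def)
  qed
  have r3: "R' i j = 0" if "j < i" for i j using that by (simp add: R'_def tri)
  have r4: "R' j j > 0" if "j < Suc p" for j using that by (cases "j < p") (simp_all add: R'_def pos \<nu>(1))
  have r5: "q' i k = (\<Sum>j<Suc p. C' i j * t j k)" if "i < Suc p" "k < n" for i k
  proof (cases "i < p")
    case True
    then show ?thesis using that by (simp add: C'_def q'_def inv)
  next
    case False
    have "(\<Sum>j<p. - b j / \<nu> * t j k) = - (\<Sum>j<p. b j * t j k) / \<nu>"
      by (simp add: sum_divide_distrib sum_negf)
    then show ?thesis
      using False comb[OF that(2)] by (simp add: C'_def q'_def u_def diff_divide_distrib)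
  qed
  show ?case
    by (intro exI[of _ q'] exI[of _ R'] exI[of _ C'] conjI allI impI) (rule r1 r2 r3 r4 r5; assumption)+
qed

lemma det_one_indep:
  assumes T: "T \<in> carrier_mat n n" and det: "Determinant.det T = (1::real)"
    and z: "\<And>k. k < n \<Longrightarrow> (\<Sum>j<n. T $$ (k, j) * c j) = 0" and j: "j < n"
  shows "c j = 0"
proof -
  have "T *\<^sub>v vec n c = 0\<^sub>v n"
    using T z by (intro eq_vecI) (simp_all add: scalar_prod_def lessThan_atLeast0)
  then have "vec n c = 0\<^sub>v n"
    using det_0_iff_vec_prod_zero_field[OF T] det vec_carrier[of n c] zero_neq_one by metis
  then have "vec n c $ j = 0\<^sub>v n $ j" by simp
  then show ?thesis using j by simp
qed

text \<open>The \<open>q i\<close> are the columns of the orthogonal factor. Its determinant has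
  square 1 and equals the product of the diagonal of \<open>R\<close>, which is positive; hence that
  product is 1. A left inverse of a square matrix is also a right inverse, so the rows are
  orthonormal too, which later gives surjectivity.\<close>

lemma qr_decomposition_det_one:
  assumes T: "T \<in> carrier_mat n n" and det: "Determinant.det T = (1::real)"
  obtains q R where
    "\<And>i j. i < n \<Longrightarrow> j < n \<Longrightarrow> dot n (q i) (q j) = (if i = j then 1 else 0)"
    "\<And>k l. k < n \<Longrightarrow> l < n \<Longrightarrow> (\<Sum>i<n. q i k * q i l) = (if k = l then 1 else 0)"
    "\<And>j k. j < n \<Longrightarrow> k < n \<Longrightarrow> T $$ (k, j) = (\<Sum>i<n. q i k * R i j)"
    "\<And>i j. j < i \<Longrightarrow> R i j = 0" "\<And>i. i < n \<Longrightarrow> R i i > 0" "(\<Prod>i<n. R i i) = 1"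
proof -
  have "\<forall>c. (\<forall>k<n. (\<Sum>j<n. c j * T $$ (k, j)) = 0) \<longrightarrow> (\<forall>j<n. c j = 0)"
    using det_one_indep[OF T det] by (simp add: mult.commute)
  from gram_schmidt_triangular[of n "\<lambda>j k. T $$ (k, j)" n, OF this order_refl]
  obtain q R where gs: "\<forall>i<n. \<forall>j<n. dot n (q i) (q j) = (if i = j then 1 else 0)"
    "\<forall>j<n. \<forall>k<n. T $$ (k, j) = (\<Sum>i<n. R i j * q i k)" "\<forall>i j. j < i \<longrightarrow> R i j = 0" "\<forall>j<n. R j j > 0"
    by (elim exE conjE) (rule that)
  have orth: "dot n (q i) (q j) = (if i = j then 1 else 0)" if "i < n" "j < n" for i j
    using gs(1) that by blast
  have dec: "T $$ (k, j) = (\<Sum>i<n. q i k * R i j)" if "j < n" "k < n" for j k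
    using gs(2) that by (simp add: mult.commute)
  have tri: "R i j = 0" if "j < i" for i j using gs(3) that by blast
  have pos: "R i i > 0" if "i < n" for i using gs(4) that by blast
  define Q where "Q = mat n n (\<lambda>(k, i). q i k)"
  define M where "M = mat n n (\<lambda>(i, j). R i j)"
  have Q: "Q \<in> carrier_mat n n" "transpose_mat Q \<in> carrier_mat n n" and M: "M \<in> carrier_mat n n"
    by (simp_all add: Q_def M_def)
  have TQM: "T = Q * M"
    by (rule eq_matI) (use T in \<open>simp_all add: Q_def M_def scalar_prod_def dec lessThan_atLeast0\<close>)
  have QQ: "transpose_mat Q * Q = 1\<^sub>m n"
    by (rule eq_matI) (simp_all add: Q_def scalar_prod_def orth[unfolded dot_def lessThan_atLeast0])
  have QQ': "Q * transpose_mat Q = 1\<^sub>m n" by (rule mat_mult_left_right_inverse[OF Q(2) Q(1) QQ])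
  have rows: "(\<Sum>i<n. q i k * q i l) = (if k = l then 1 else 0)" if "k < n" "l < n" for k l
  proof -
    have "(\<Sum>i<n. q i k * q i l) = (Q * transpose_mat Q) $$ (k, l)"
      using that by (simp add: Q_def scalar_prod_def lessThan_atLeast0)
    also have "\<dots> = (if k = l then 1 else 0)" unfolding QQ' using that by simp
    finally show ?thesis .
  qed
  have "upper_triangular M" by (rule upper_triangularI) (simp_all add: M_def tri)
  then have "Determinant.det M = prod_list (diag_mat M)" using M by (rule det_upper_triangular)
  also have "\<dots> = (\<Prod>i<n. R i i)"
    by (simp add: diag_mat_def M_def prod.list_conv_set_nth lessThan_atLeast0)
  finally have dM: "Determinant.det M = (\<Prod>i<n. R i i)" .
  have P: "(\<Prod>i<n. R i i) > 0" using pos by (intro prod_pos) simp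
  have dQ: "Determinant.det Q * Determinant.det Q = 1"
    using arg_cong[OF QQ, of Determinant.det] det_mult[OF Q(2) Q(1)] det_transpose[OF Q(1)] by simp
  have dP: "Determinant.det Q * (\<Prod>i<n. R i i) = 1"
    using det det_mult[OF Q(1) M] unfolding TQM dM by simp
  have "(\<Prod>i<n. R i i) = Determinant.det Q * (Determinant.det Q * (\<Prod>i<n. R i i))"
    unfolding mult.assoc[symmetric] dQ by simp
  then have "(\<Prod>i<n. R i i)\<^sup>2 = 1" using dP dQ by (simp add: power2_eq_square)
  with P have P1: "(\<Prod>i<n. R i i) = 1" by (simp add: power2_eq_1_iff)
  show thesis
    by (rule that[of q R]) (rule orth rows dec tri pos P1; assumption)+
qed

section \<open>Orthogonal maps given by orthonormal columns\<close>

lemma lin_map_add: "lin_map n R (x + y) = lin_map n R x + lin_map n R y"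
  by (simp add: lin_map_def fun_eq_iff distrib_left sum.distrib)

lemma lin_map_scaleR: "lin_map n R (s *\<^sub>R x) = s *\<^sub>R lin_map n R x"
  by (simp add: lin_map_def fun_eq_iff scaleR_fun_def sum_distrib_left mult.left_commute)

lemma L2_set_eq_sqrt_dot: "L2_set x {..<n} = sqrt (dot n x x)"
  by (simp add: L2_set_def dot_def power2_eq_square)

lemma dot_sum_left: "dot n (\<lambda>k. \<Sum>i\<in>I. x i * q i k) y = (\<Sum>i\<in>I. x i * dot n (q i) y)"
  unfolding dot_def sum_distrib_left sum_distrib_right mult.assoc by (rule sum.swap)

text \<open>The number \<open>p\<close> of vectors is separate from the dimension \<open>n\<close>:
  orthogonal maps use \<open>p = n\<close>, bases of a hyperplane use one vector fewer than the
  dimension.\<close>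

lemma dot_sum_orthonormal:
  assumes orth: "\<And>i j. i < p \<Longrightarrow> j < p \<Longrightarrow> dot n (q i) (q j) = (if i = j then 1 else 0)"
  shows "j < p \<Longrightarrow> dot n (\<lambda>k. \<Sum>i<p. x i * q i k) (q j) = x j"
    and "dot n (\<lambda>k. \<Sum>i<p. x i * q i k) (\<lambda>k. \<Sum>i<p. x i * q i k) = dot p x x"
proof -
  show *: "dot n (\<lambda>k. \<Sum>i<p. x i * q i k) (q j) = x j" if "j < p" for j
  proof -
    have "dot n (\<lambda>k. \<Sum>i<p. x i * q i k) (q j) = (\<Sum>i<p. if i = j then x i else 0)"
      unfolding dot_sum_left by (rule sum.cong) (use that in \<open>simp_all add: orth\<close>)
    also have "\<dots> = x j" using that by simp
    finally show ?thesis .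
  qed
  have "dot n (\<lambda>k. \<Sum>i<p. x i * q i k) (\<lambda>k. \<Sum>i<p. x i * q i k) =
      (\<Sum>i<p. x i * dot n (\<lambda>k. \<Sum>i<p. x i * q i k) (q i))"
    unfolding dot_sum_left[of n x _ _ "\<lambda>k. \<Sum>i<p. x i * q i k"] by (simp only: dot_commute)
  also have "\<dots> = dot p x x" unfolding dot_def[of p] by (rule sum.cong) (simp_all add: *)
  finally show "dot n (\<lambda>k. \<Sum>i<p. x i * q i k) (\<lambda>k. \<Sum>i<p. x i * q i k) = dot p x x" .
qed

lemma L2_set_lin_map_orthonormal:
  assumes "\<And>i j. i < n \<Longrightarrow> j < n \<Longrightarrow> dot n (q i) (q j) = (if i = j then 1 else 0)"
  shows "L2_set (lin_map n (\<lambda>k i. q i k) x) {..<n} = L2_set x {..<n}"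
proof -
  have "L2_set (lin_map n (\<lambda>k i. q i k) x) {..<n} = L2_set (\<lambda>k. \<Sum>i<n. x i * q i k) {..<n}"
    by (rule L2_set_cong) (simp_all add: lin_map_def mult.commute)
  then show ?thesis
    by (simp add: L2_set_eq_sqrt_dot dot_sum_orthonormal(2)[of n n q, OF assms])
qed

lemma nn_integral_eucl_lborel_orthonormal:
  fixes g :: "(nat \<Rightarrow> real) \<Rightarrow> ennreal"
  assumes g: "g \<in> borel_measurable borel"
    and orth: "\<And>i j. i < n \<Longrightarrow> j < n \<Longrightarrow> dot n (q i) (q j) = (if i = j then 1 else 0)"
    and rows: "\<And>k l. k < n \<Longrightarrow> l < n \<Longrightarrow> (\<Sum>i<n. q i k * q i l) = (if k = l then 1 else 0)"
  shows "(\<integral>\<^sup>+x. g (lin_map n (\<lambda>k i. q i k) x) \<partial>eucl_lborel n) = (\<integral>\<^sup>+x. g x \<partial>eucl_lborel n)"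
proof (rule nn_integral_eucl_lborel_isometry[OF g])
  show "lin_map n (\<lambda>k i. q i k) \<in> borel_measurable borel"
    by (rule borel_measurable_continuous_onI[OF continuous_on_lin_map])
  show "L2_set (lin_map n (\<lambda>k i. q i k) x) {..<n} = L2_set x {..<n}" for x
    by (rule L2_set_lin_map_orthonormal[OF orth])
  show "\<exists>w\<in>eucl n. lin_map n (\<lambda>k i. q i k) w = v" if v: "v \<in> eucl n" for v
  proof
    \<comment> \<open>The transpose serves as inverse; orthonormality of the rows gives the required
      composition.\<close>
    let ?w = "lin_map n q v"
    show "?w \<in> eucl n" by (rule lin_map_in_eucl)
    show "lin_map n (\<lambda>k i. q i k) ?w = v"
    proof
      fix k
      show "lin_map n (\<lambda>k i. q i k) ?w k = v k"
      proof (cases "k < n")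
        case True
        have "lin_map n (\<lambda>k i. q i k) ?w k = (\<Sum>i<n. \<Sum>l<n. q i k * q i l * v l)"
          using True by (simp add: lin_map_def sum_distrib_left mult.assoc)
        also have "\<dots> = (\<Sum>l<n. (\<Sum>i<n. q i k * q i l) * v l)"
          unfolding sum_distrib_right by (rule sum.swap)
        also have "\<dots> = (\<Sum>l<n. if k = l then v l else 0)"
          using True by (intro sum.cong) (auto simp: rows)
        also have "\<dots> = v k" using True by simp
        finally show ?thesis .
      qed (use v in \<open>simp add: lin_map_def in_eucl_iff\<close>)
    qed
  qed
qed (rule lin_map_add, rule lin_map_in_eucl)

lemma minimal_surface_area_cylinder:
  assumes r: "r > 0"
  shows "minimal_surface_area (Suc m) (cylinder m r)"
  unfolding minimal_surface_area_def
proof (intro ballI impI)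
  let ?n = "Suc m"
  fix T :: "real mat" assume T: "T \<in> carrier_mat ?n ?n" and det: "Determinant.det T = 1"
  obtain q R where orth: "\<And>i j. i < ?n \<Longrightarrow> j < ?n \<Longrightarrow> dot ?n (q i) (q j) = (if i = j then 1 else 0)"
    and rows: "\<And>k l. k < ?n \<Longrightarrow> l < ?n \<Longrightarrow> (\<Sum>i<?n. q i k * q i l) = (if k = l then 1 else 0)"
    and dec: "\<And>j k. j < ?n \<Longrightarrow> k < ?n \<Longrightarrow> T $$ (k, j) = (\<Sum>i<?n. q i k * R i j)"
    and tri: "\<And>i j. j < i \<Longrightarrow> R i j = 0" and pos: "\<And>i. i < ?n \<Longrightarrow> R i i > 0"
    and P: "(\<Prod>i<?n. R i i) = 1"
    by (rule qr_decomposition_det_one[OF T det]) (rule that)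
  define Q where "Q = lin_map ?n (\<lambda>k i. q i k)"
  define F where "F = lin_map ?n (\<lambda>i j. T $$ (i, j))"
  have img: "mat_image T A = F ` A" for A
    unfolding mat_image_def F_def lin_map_def[abs_def] carrier_matD[OF T] ..
  have FQ: "F x = Q (lin_map ?n R x)" for x
  proof
    fix k
    show "F x k = Q (lin_map ?n R x) k"
    proof (cases "k < ?n")
      case True
      have "F x k = (\<Sum>j<?n. \<Sum>i<?n. q i k * R i j * x j)"
        unfolding F_def lin_map_def using True by (simp add: dec sum_distrib_right del: sum.lessThan_Suc)
      also have "\<dots> = (\<Sum>i<?n. \<Sum>j<?n. q i k * R i j * x j)" by (rule sum.swap)
      also have "\<dots> = Q (lin_map ?n R x) k"
        unfolding Q_def lin_map_def using True
        by (simp add: sum_distrib_left mult.assoc del: sum.lessThan_Suc)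
      finally show ?thesis .
    qed (simp add: F_def Q_def lin_map_def)
  qed
  let ?K = "cylinder m r"
  have cT: "compact (F ` ?K)"
    unfolding F_def by (intro compact_continuous_image continuous_on_lin_map compact_cylinder)
  have eT: "F ` ?K \<subseteq> eucl ?n" by (auto simp: F_def lin_map_in_eucl)
  have inj: "x = y" if "F x = F y" "x \<in> eucl ?n" "y \<in> eucl ?n" for x y
  proof
    fix j
    have "(\<Sum>j<?n. T $$ (k, j) * (x j - y j)) = 0" if "k < ?n" for k
      using fun_cong[OF \<open>F x = F y\<close>, of k] that
      by (simp add: F_def lin_map_def right_diff_distrib sum_subtractf del: sum.lessThan_Suc)
    then have "j < ?n \<Longrightarrow> x j - y j = 0" by (rule det_one_indep[OF T det])
    then show "x j = y j" using that by (cases "j < ?n") (simp_all add: in_eucl_iff)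
  qed
  have bT: "indicator (F ` ?K) \<in> borel_measurable (borel :: (nat \<Rightarrow> real) measure)"
    using compact_imp_borel[OF cT] by simp
  have Qm: "Q \<in> borel_measurable borel"
    unfolding Q_def by (rule borel_measurable_continuous_onI[OF continuous_on_lin_map])
  \<comment> \<open>The volume does not grow under the map: \<open>Q\<close> preserves integrals and
    the triangular factor has determinant 1. The inequality comes from pulling back the indicator,
    where injectivity on \<open>eucl ?n\<close> recovers \<open>x\<close> from
    \<open>F x\<close>.\<close>
  have "emeasure (eucl_lborel ?n) (F ` ?K) = (\<integral>\<^sup>+x. indicator (F ` ?K) x \<partial>eucl_lborel ?n)"
    using compact_imp_borel[OF cT] by simp
  also have "\<dots> = (\<integral>\<^sup>+x. indicator (F ` ?K) (Q x) \<partial>eucl_lborel ?n)"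
    unfolding Q_def by (rule nn_integral_eucl_lborel_orthonormal[OF bT orth rows, symmetric])
  also have "\<dots> = ennreal (\<Prod>i<?n. R i i) * (\<integral>\<^sup>+x. indicator (F ` ?K)
      (Q (\<lambda>i. if i < ?n then (\<Sum>j<?n. R i j * x j) + 0 else x i)) \<partial>eucl_lborel ?n)"
    by (rule nn_integral_eucl_lborel_triangular[OF measurable_compose[OF Qm bT] tri pos, symmetric])
  also have "\<dots> = (\<integral>\<^sup>+x. indicator (F ` ?K)
      (Q (\<lambda>i. if i < ?n then (\<Sum>j<?n. R i j * x j) + 0 else x i)) \<partial>eucl_lborel ?n)"
    unfolding P by simp
  also have "\<dots> \<le> (\<integral>\<^sup>+x. indicator ?K x \<partial>eucl_lborel ?n)"
  proof (rule nn_integral_mono_AE[OF AE_mp[OF AE_eucl_lborel_eucl AE_I2]], rule impI)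
    fix x :: "nat \<Rightarrow> real" assume x: "x \<in> eucl ?n"
    have "(\<lambda>i. if i < ?n then (\<Sum>j<?n. R i j * x j) + 0 else x i) = lin_map ?n R x"
      using x by (auto simp: fun_eq_iff lin_map_def in_eucl_iff simp del: sum.lessThan_Suc)
    moreover have "x \<in> ?K" if "F x \<in> F ` ?K"
      using that inj[OF _ x] cylinder_subset_eucl[of m r] by auto
    ultimately show "indicator (F ` ?K) (Q (\<lambda>i. if i < ?n then (\<Sum>j<?n. R i j * x j) + 0 else x i))
        \<le> (indicator ?K x :: ennreal)"
      by (simp add: FQ[symmetric] indicator_def del: sum.lessThan_Suc)
  qed
  also have "\<dots> = emeasure (eucl_lborel ?n) ?K" using compact_imp_borel[OF compact_cylinder] by simp
  finally have vT: "vol ?n (F ` ?K) \<le> vol ?n ?K"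
    by (simp add: emeasure_eucl_lborel_compact cT eT compact_cylinder cylinder_subset_eucl)
  have "ereal (real ?n / r * vol ?n ?K) \<le> surface_area ?n (F ` ?K)"
  proof (rule surface_area_ge_linear[OF vT])
    fix e :: real assume e: "e > 0"
    let ?A = "parallel_body ?n (lin_map ?n R ` ?K) e"
    let ?B = "parallel_body ?n (F ` ?K) e"
    have A: "compact ?A" "?A \<subseteq> eucl ?n"
      by (intro compact_parallel_body compact_continuous_image continuous_on_lin_map compact_cylinder)
        (intro parallel_body_subset_eucl, auto simp: lin_map_in_eucl)
    have B: "compact ?B" "?B \<subseteq> eucl ?n"
      by (intro compact_parallel_body cT, rule parallel_body_subset_eucl[OF eT])
    \<comment> \<open>\<open>Q\<close> preserves the unit ball, hence carries the parallel body of
      the triangular image into that of the full image.\<close>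
    have QA: "Q z \<in> ?B" if z: "z \<in> ?A" for z
    proof -
      obtain x y where xy: "x \<in> ?K" "y \<in> unit_ball ?n" "z = lin_map ?n R x + e *\<^sub>R y"
        using z unfolding parallel_body_def by blast
      have "Q z = F x + e *\<^sub>R Q y"
        unfolding xy(3) FQ by (simp only: Q_def lin_map_add lin_map_scaleR)
      moreover have "Q y \<in> unit_ball ?n"
        using xy(2) L2_set_lin_map_orthonormal[OF orth, of y]
        by (simp add: unit_ball_def Q_def lin_map_in_eucl)
      ultimately show ?thesis using xy(1) unfolding parallel_body_def by blast
    qed
    have "emeasure (eucl_lborel ?n) ?A = (\<integral>\<^sup>+x. indicator ?A x \<partial>eucl_lborel ?n)"
      using compact_imp_borel[OF A(1)] by simp
    also have "\<dots> \<le> (\<integral>\<^sup>+x. indicator ?B (Q x) \<partial>eucl_lborel ?n)"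
      by (rule nn_integral_mono) (simp add: indicator_def QA)
    also have "\<dots> = (\<integral>\<^sup>+x. indicator ?B x \<partial>eucl_lborel ?n)"
      unfolding Q_def using compact_imp_borel[OF B(1)]
      by (intro nn_integral_eucl_lborel_orthonormal orth rows) simp_all
    also have "\<dots> = emeasure (eucl_lborel ?n) ?B" using compact_imp_borel[OF B(1)] by simp
    finally have "vol ?n ?A \<le> vol ?n ?B" by (simp add: emeasure_eucl_lborel_compact A B)
    with vol_parallel_body_triangular_cylinder_ge[where R = R, OF tri pos P r e]
    show "vol ?n ?K * (1 + real ?n / r * e) \<le> vol ?n ?B" by simp
  qed
  then show "surface_area ?n ?K \<le> surface_area ?n (mat_image T ?K)"
    unfolding img surface_area_cylinder[OF r] .
qed

section \<open>Projections of the cylinder\<close>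

lemma dot_minus_scale:
  "dot n (\<lambda>k. a k - s * w k) y = dot n a y - s * dot n w y"
  "dot n y (\<lambda>k. a k - s * w k) = dot n y a - s * dot n y w"
  by (simp_all add: dot_def left_diff_distrib right_diff_distrib sum_subtractf sum_distrib_left ac_simps)

lemma dot_std_basis:
  assumes "i < n" shows "dot n (\<lambda>k. if k = i then 1 else 0) y = y i"
  using assms by (simp add: dot_def if_distrib[of "\<lambda>a. a * _"] cong: if_cong)

text \<open>The reflection that exchanges the last basis vector and \<open>\<eta>\<close> maps the other basis vectors
  to an orthonormal basis of the complement of \<open>\<eta>\<close>. If \<open>\<eta>\<close> is the last basis vector itself, then
  \<open>D = 0\<close> and division by zero makes the reflection the identity.\<close>

lemma orthonormal_basis_perp_exists:
  assumes \<eta>: "\<eta> \<in> unit_sphere (Suc m)"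
  shows "\<exists>b. orthonormal_basis_perp (Suc m) \<eta> b"
proof -
  let ?n = "Suc m"
  define e :: "nat \<Rightarrow> nat \<Rightarrow> real" where "e i = (\<lambda>k. if k = i then 1 else 0)" for i
  \<comment> \<open>The factor \<open>1\<close> makes the difference an instance of
    \<open>dot_minus_scale\<close>.\<close>
  define w where "w k = \<eta> k - 1 * e m k" for k
  define D where "D = dot ?n w w"
  \<comment> \<open>The Householder formula applied to \<open>e i\<close>, whose product with
    \<open>w\<close> is \<open>\<eta> i\<close> for \<open>i < m\<close>.\<close>
  define b where "b i k = e i k - 2 * \<eta> i / D * w k" for i k
  have \<eta>1: "dot ?n \<eta> \<eta> = 1"
    using \<eta> by (simp add: unit_sphere_def L2_set_eq_sqrt_dot)
  have e: "dot ?n (e i) y = y i" if "i < ?n" for i y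
    unfolding e_def using that by (rule dot_std_basis)
  have e': "dot ?n y (e i) = y i" if "i < ?n" for i y
    using e[OF that] by (simp add: dot_commute)
  have w\<eta>: "dot ?n w \<eta> = 1 - \<eta> m"
    unfolding w_def dot_minus_scale by (simp add: \<eta>1 e del: sum.lessThan_Suc)
  have "dot ?n w (e m) = \<eta> m - 1"
    unfolding w_def dot_minus_scale by (simp add: e e') (simp add: e_def)
  then have D: "D = 2 * (1 - \<eta> m)"
    unfolding D_def w_def[of] dot_minus_scale(2)[of _ w \<eta> 1 "e m", folded w_def]
    using w\<eta> by (simp add: w_def[abs_def])
  have wi: "w i = \<eta> i" if "i < m" for i using that by (simp add: w_def e_def)
  have we: "dot ?n w (e i) = \<eta> i" "dot ?n (e i) w = \<eta> i" if "i < m" for i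
    using that by (simp_all add: e e' wi)
  have D0: "\<eta> i = 0" if "D = 0" "i < m" for i
  proof -
    have "\<forall>k\<in>{..<?n}. w k * w k = 0"
      using that(1) unfolding D_def dot_def by (subst (asm) sum_nonneg_eq_0_iff) simp_all
    then have "w i = 0" using that(2) by simp
    then show ?thesis using wi[OF that(2)] by simp
  qed
  have "dot ?n (b i) \<eta> = 0" if "i < m" for i
  proof (cases "D = 0")
    case True
    then show ?thesis
      unfolding b_def dot_minus_scale using that D0[OF True that] by (simp add: e)
  next
    case False
    have half: "1 - \<eta> m = D / 2" using D by simp
    show ?thesis
      unfolding b_def dot_minus_scale w\<eta> half using False that by (simp add: e)
  qed
  moreover have "dot ?n (b i) (b j) = (if i = j then 1 else 0)" if "i < m" "j < m" for i j
  proof -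
    have "dot ?n (b i) (b j) = e i j - 2 * \<eta> j / D * \<eta> i - 2 * \<eta> i / D * (\<eta> j - 2 * \<eta> j / D * D)"
      unfolding b_def dot_minus_scale D_def[symmetric] using that by (simp add: we e' wi)
    also have "\<dots> = e i j" by (cases "D = 0") (simp_all add: field_simps)
    finally show ?thesis by (simp add: e_def)
  qed
  moreover have "b i \<in> eucl ?n" if "i < m" for i
    using that \<eta> by (simp add: in_eucl_iff b_def e_def w_def unit_sphere_def)
  ultimately have "orthonormal_basis_perp ?n \<eta> b"
    unfolding orthonormal_basis_perp_def by simp
  then show ?thesis by (intro exI[of _ b])
qed

definition perp_coords :: "nat \<Rightarrow> (nat \<Rightarrow> nat \<Rightarrow> real) \<Rightarrow> (nat \<Rightarrow> real) \<Rightarrow> nat \<Rightarrow> real" where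
  "perp_coords m b x = (\<lambda>i. if i < m then dot (Suc m) x (b i) else 0)"

text \<open>The basis picked by \<open>SOME\<close> is unknown. The facts about coordinates below
  hold for every orthonormal basis of the hyperplane, so independence of the choice never has to be
  shown.\<close>

lemma surface_area_perp_obtain_basis:
  assumes "\<eta> \<in> unit_sphere (Suc m)"
  obtains b where "orthonormal_basis_perp (Suc m) \<eta> b"
    "\<And>A. surface_area_perp (Suc m) \<eta> A = surface_area m (perp_coords m b ` A)"
proof
  let ?b = "SOME b. orthonormal_basis_perp (Suc m) \<eta> b"
  show "orthonormal_basis_perp (Suc m) \<eta> ?b"
    by (rule someI_ex[OF orthonormal_basis_perp_exists[OF assms]])
  show "surface_area_perp (Suc m) \<eta> A = surface_area m (perp_coords m ?b ` A)" for A
    by (simp add: surface_area_perp_def perp_coords_def[abs_def])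
qed

lemma continuous_on_perp_coords_proj: "continuous_on S (\<lambda>x. perp_coords m b (proj_perp (Suc m) \<eta> x))"
proof (rule continuous_on_coordinatewise_then_product)
  fix i
  have "continuous_on S (\<lambda>x. dot (Suc m) (proj_perp (Suc m) \<eta> x) (b i))"
    unfolding dot_def proj_perp_def fun_diff_def scaleR_fun_def real_scaleR_def
    by (intro continuous_on_sum continuous_on_mult_right continuous_on_diff continuous_on_coord)
  then show "continuous_on S (\<lambda>x. perp_coords m b (proj_perp (Suc m) \<eta> x) i)"
    by (cases "i < m") (simp_all add: perp_coords_def)
qed

text \<open>The central section of the ball suffices: the point of the hyperplane with coordinates
  \<open>z\<close> has the same norm as \<open>z\<close> and is fixed by the projection.\<close>

lemma eucl_ball_subset_perp_coords:
  assumes b: "orthonormal_basis_perp (Suc m) \<eta> b" and K: "eucl_ball (Suc m) r \<subseteq> K"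
  shows "eucl_ball m r \<subseteq> perp_coords m b ` proj_perp (Suc m) \<eta> ` K"
proof
  fix z assume z: "z \<in> eucl_ball m r"
  have orth: "dot (Suc m) (b i) (b j) = (if i = j then 1 else 0)" if "i < m" "j < m" for i j
    using b that by (simp add: orthonormal_basis_perp_def)
  define x where "x = (\<lambda>k. \<Sum>i<m. z i * b i k)"
  have "x \<in> eucl (Suc m)"
    using b by (simp add: x_def in_eucl_iff orthonormal_basis_perp_def)
  moreover have "L2_set x {..<Suc m} = L2_set z {..<m}"
    unfolding L2_set_eq_sqrt_dot x_def by (simp only: dot_sum_orthonormal(2)[of m "Suc m" b, OF orth])
  ultimately have "x \<in> K" using z K by (auto simp: eucl_ball_def)
  have "dot (Suc m) x \<eta> = 0"
    unfolding x_def dot_sum_left using b by (simp add: orthonormal_basis_perp_def)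
  then have "proj_perp (Suc m) \<eta> x = x" by (simp add: proj_perp_def)
  moreover have "perp_coords m b x = z"
    using z dot_sum_orthonormal(1)[of m "Suc m" b, OF orth]
    by (auto simp: perp_coords_def x_def fun_eq_iff eucl_ball_def in_eucl_iff)
  ultimately show "z \<in> perp_coords m b ` proj_perp (Suc m) \<eta> ` K"
    using \<open>x \<in> K\<close> by (metis image_eqI)
qed

text \<open>Supplies the upper inclusion for the projection along the axis, where the chosen basis
  may differ from the standard one.\<close>

lemma bessel_perp_coords:
  assumes b: "orthonormal_basis_perp (Suc m) \<eta> b"
  shows "L2_set (perp_coords m b x) {..<m} \<le> L2_set x {..<Suc m}"
proof -
  have orth: "dot (Suc m) (b i) (b j) = (if i = j then 1 else 0)" if "i < m" "j < m" for i j
    using b that by (simp add: orthonormal_basis_perp_def)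
  let ?c = "perp_coords m b x"
  let ?p = "\<lambda>k. \<Sum>i<m. ?c i * b i k"
  have px: "dot (Suc m) ?p x = dot m ?c ?c"
    unfolding dot_sum_left unfolding dot_def[of m]
    by (rule sum.cong) (simp_all add: perp_coords_def dot_commute)
  have px': "dot (Suc m) x ?p = dot m ?c ?c" using px by (simp only: dot_commute)
  have pp: "dot (Suc m) ?p ?p = dot m ?c ?c" by (rule dot_sum_orthonormal(2)[OF orth])
  have "0 \<le> dot (Suc m) (\<lambda>k. x k - 1 * ?p k) (\<lambda>k. x k - 1 * ?p k)"
    unfolding dot_def by (intro sum_nonneg) simp
  also have "\<dots> = dot (Suc m) x x - dot m ?c ?c"
    unfolding dot_minus_scale using px px' pp by simp
  finally show ?thesis by (simp add: L2_set_eq_sqrt_dot)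
qed

lemma unit_vector_in_unit_sphere: "(\<lambda>k. if k = m then 1 else 0) \<in> unit_sphere (Suc m)"
  by (simp add: unit_sphere_def in_eucl_iff L2_set_eq_sqrt_dot dot_std_basis)

lemma surface_area_perp_cylinder_axis:
  assumes r: "r > 0"
  shows "surface_area_perp (Suc m) (\<lambda>k. if k = m then 1 else 0)
      (proj_perp (Suc m) (\<lambda>k. if k = m then 1 else 0) ` cylinder m r) = surface_area m (eucl_ball m r)"
proof -
  let ?\<xi> = "\<lambda>k. if k = m then 1 else 0 :: real"
  obtain b where b: "orthonormal_basis_perp (Suc m) ?\<xi> b"
    and S: "\<And>A. surface_area_perp (Suc m) ?\<xi> A = surface_area m (perp_coords m b ` A)"
    by (rule surface_area_perp_obtain_basis[OF unit_vector_in_unit_sphere[of m]]) (rule that)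
  have "perp_coords m b ` proj_perp (Suc m) ?\<xi> ` cylinder m r \<subseteq> eucl_ball m r"
  proof -
    have "perp_coords m b (proj_perp (Suc m) ?\<xi> x) \<in> eucl_ball m r" if x: "x \<in> cylinder m r" for x
    proof -
      let ?y = "proj_perp (Suc m) ?\<xi> x"
      have y: "?y k = (if k = m then 0 else x k)" for k
        using dot_std_basis[of m "Suc m" x]
        by (simp add: proj_perp_def scaleR_fun_def dot_commute[of _ x])
      have "L2_set ?y {..<m} = L2_set x {..<m}" by (rule L2_set_cong) (simp_all add: y)
      then have "L2_set ?y {..<Suc m} \<le> r"
        using x by (simp add: L2_set_Suc y cylinder_def)
      then have "L2_set (perp_coords m b ?y) {..<m} \<le> r"
        using bessel_perp_coords[OF b, of ?y] by linarith
      then show ?thesis by (simp add: eucl_ball_def perp_coords_def in_eucl_iff)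
    qed
    then show ?thesis by blast
  qed
  moreover have "eucl_ball m r \<subseteq> perp_coords m b ` proj_perp (Suc m) ?\<xi> ` cylinder m r"
    by (rule eucl_ball_subset_perp_coords[OF b eucl_ball_subset_cylinder])
  ultimately have "perp_coords m b ` proj_perp (Suc m) ?\<xi> ` cylinder m r = eucl_ball m r" by (rule antisym)
  then show ?thesis by (simp only: S)
qed

lemma surface_area_perp_cylinder_ge:
  assumes r: "r > 0" and \<eta>: "\<eta> \<in> unit_sphere (Suc m)"
  shows "surface_area m (eucl_ball m r) \<le> surface_area_perp (Suc m) \<eta> (proj_perp (Suc m) \<eta> ` cylinder m r)"
proof -
  obtain b where b: "orthonormal_basis_perp (Suc m) \<eta> b"
    and S: "\<And>A. surface_area_perp (Suc m) \<eta> A = surface_area m (perp_coords m b ` A)"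
    by (rule surface_area_perp_obtain_basis[OF \<eta>]) (rule that)
  let ?L = "perp_coords m b ` proj_perp (Suc m) \<eta> ` cylinder m r"
  have "compact ?L"
    unfolding image_image
    by (intro compact_continuous_image continuous_on_perp_coords_proj compact_cylinder)
  moreover have "?L \<subseteq> eucl m" by (auto simp: perp_coords_def in_eucl_iff)
  ultimately show ?thesis
    unfolding S by (rule surface_area_ge_eucl_ball[OF _ _ r eucl_ball_subset_perp_coords[OF b eucl_ball_subset_cylinder]])
qed

section \<open>The volume of the ball\<close>

lemma unit_ball_vol_add_2:
  assumes "n \<ge> 0" shows "unit_ball_vol (n + 2) = 2 * pi / (n + 2) * unit_ball_vol n"
proof -
  have "n / 2 + 1 \<notin> \<int>\<^sub>\<le>\<^sub>0" using assms nonpos_Ints_nonpos[of "n / 2 + 1"] by force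
  then have "Gamma (n / 2 + 1 + 1) = (n / 2 + 1) * Gamma (n / 2 + 1)" by (rule Gamma_plus1)
  moreover have "(n + 2) / 2 = n / 2 + 1" by simp
  ultimately have "unit_ball_vol (n + 2) = pi powr (n / 2 + 1) / ((n / 2 + 1) * Gamma (n / 2 + 1))"
    unfolding unit_ball_vol_def by (simp only:)
  also have "pi powr (n / 2 + 1) = pi powr (n / 2) * pi" by (simp add: powr_add)
  also have "(n / 2 + 1) * Gamma (n / 2 + 1) = (n + 2) / 2 * Gamma (n / 2 + 1)" by simp
  also have "pi powr (n / 2) * pi / ((n + 2) / 2 * Gamma (n / 2 + 1)) =
      2 * pi / (n + 2) * (pi powr (n / 2) / Gamma (n / 2 + 1))"
    by simp
  finally show ?thesis unfolding unit_ball_vol_def .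
qed

lemma add_power_le_exp: "(x + real k) ^ n \<le> exp (real k) * x ^ n" if "x = real n" for x n k
proof (cases "n = 0")
  case False
  then have "(x + real k) ^ n = (1 + real k / x) ^ n * x ^ n"
    using that by (simp add: power_mult_distrib[symmetric] field_simps)
  also have "(1 + real k / x) ^ n \<le> exp (real k / x) ^ n"
    using that by (intro power_mono exp_ge_add_one_self) simp
  also have "exp (real k / x) ^ n = exp (real k)"
    using that False by (simp add: exp_of_nat_mult[symmetric])
  finally show ?thesis using that by (simp add: mult_right_mono)
qed simp

text \<open>Squaring avoids fractional powers. Passing from \<open>n\<close> to \<open>n + 2\<close>
  multiplies the left side by at most \<open>4 * pi\<^sup>2 * (exp 1)\<^sup>2\<close>, which the
  bounds 4 for \<open>pi\<close> and 3 for \<open>exp 1\<close> estimate by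
  \<open>576 = 24\<^sup>2\<close>.\<close>

lemma unit_ball_vol_sq_le: "(unit_ball_vol (real n))\<^sup>2 * real n ^ n \<le> 24 ^ n"
proof (induction n rule: nat_induct2)
  case 0
  show ?case by simp
next
  case 1
  show ?case by simp
next
  case (step n)
  have "(unit_ball_vol (real (n + 2)))\<^sup>2 * real (n + 2) ^ (n + 2) =
      4 * pi\<^sup>2 * (unit_ball_vol (real n))\<^sup>2 * (real n + real 2) ^ n"
    using unit_ball_vol_add_2[of "real n"]
    by (simp add: power_mult_distrib power_divide power_add power2_eq_square add.commute)
  also have "\<dots> \<le> 4 * pi\<^sup>2 * (unit_ball_vol (real n))\<^sup>2 * (exp (real 2) * real n ^ n)"
    by (intro mult_left_mono add_power_le_exp) simp_all
  also have "\<dots> = 4 * pi\<^sup>2 * (exp 1)\<^sup>2 * ((unit_ball_vol (real n))\<^sup>2 * real n ^ n)"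
    by (simp add: exp_of_nat_mult[symmetric] power2_eq_square exp_add[symmetric])
  also have "\<dots> \<le> 4 * 4\<^sup>2 * 3\<^sup>2 * 24 ^ n"
    using step pi_less_4 exp_le
    by (intro mult_mono power_mono mult_nonneg_nonneg) simp_all
  finally show ?case by simp
qed

text \<open>The squared volume equation reduces the claim to a bound by \<open>64 ^ Suc m\<close>,
  followed by a root. Replacing \<open>m\<close> by \<open>m + 1\<close> in the power costs a factor
  3, the remaining factor \<open>m + 1\<close> costs \<open>2 ^ m\<close>, and together with 24 this
  gives \<open>12 * 48 ^ m\<close>; 64 is the next square of a convenient integer.\<close>

lemma dimension_le_of_cylinder_volume:
  assumes r: "r > 0" and V: "2 * r * (unit_ball_vol (real m) * r ^ m) = 1"
  shows "real (Suc m) \<le> (8 * r)\<^sup>2"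
proof -
  let ?V = "unit_ball_vol (real m)"
  have "real (Suc m) ^ m = (real m + real 1) ^ m" by (simp add: add.commute)
  also have "\<dots> \<le> exp (real 1) * real m ^ m" by (rule add_power_le_exp) simp
  also have "\<dots> \<le> 3 * real m ^ m" using exp_le by (intro mult_right_mono) simp_all
  finally have pow: "real (Suc m) ^ m \<le> 3 * real m ^ m" .
  have two: "real (Suc m) \<le> 2 ^ m"
    using less_exp[of m] by (metis Suc_leI of_nat_le_iff of_nat_numeral of_nat_power)
  have "4 * ?V\<^sup>2 * real (Suc m) ^ Suc m = 4 * real (Suc m) * (?V\<^sup>2 * real (Suc m) ^ m)" by simp
  also have "\<dots> \<le> 4 * 2 ^ m * (?V\<^sup>2 * (3 * real m ^ m))"
    by (intro mult_mono mult_left_mono pow two) simp_all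
  also have "\<dots> = 12 * 2 ^ m * (?V\<^sup>2 * real m ^ m)" by simp
  also have "\<dots> \<le> 12 * 2 ^ m * 24 ^ m" by (intro mult_left_mono unit_ball_vol_sq_le) simp
  also have "\<dots> = 12 * 48 ^ m" by (simp add: power_mult_distrib[symmetric])
  also have "\<dots> \<le> 64 * 64 ^ m" by (intro mult_mono power_mono) simp_all
  finally have le: "4 * ?V\<^sup>2 * real (Suc m) ^ Suc m * (r ^ Suc m)\<^sup>2 \<le> 64 ^ Suc m * (r ^ Suc m)\<^sup>2"
    by (intro mult_right_mono) simp_all
  have lhs: "4 * ?V\<^sup>2 * real (Suc m) ^ Suc m * (r ^ Suc m)\<^sup>2 =
      (2 * r * (?V * r ^ m))\<^sup>2 * real (Suc m) ^ Suc m"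
    by (simp add: power_mult_distrib)
  have rhs: "64 ^ Suc m * (r ^ Suc m)\<^sup>2 = ((8 * r)\<^sup>2) ^ Suc m"
    by (simp add: power_mult_distrib power_mult[symmetric] mult.commute)
  have "real (Suc m) ^ Suc m \<le> ((8 * r)\<^sup>2) ^ Suc m"
    using le unfolding lhs rhs V by (simp only: power_one mult_1_left)
  then show ?thesis by (rule power_le_imp_le_base) simp
qed

theorem proposition4p6:
  shows "\<exists>c::real. c > 0 \<and>
    (\<forall>n::nat. n \<ge> 2 \<longrightarrow>
      (\<exists>K\<^sub>0. convex_body n K\<^sub>0 \<and> unconditional n K\<^sub>0 \<and> vol n K\<^sub>0 = 1 \<and> minimal_surface_area n K\<^sub>0 \<and>
        (\<exists>\<xi> \<in> unit_sphere n.
          (\<forall>\<eta> \<in> unit_sphere n.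
             surface_area_perp n \<xi> (proj_perp n \<xi> ` K\<^sub>0) \<le> surface_area_perp n \<eta> (proj_perp n \<eta> ` K\<^sub>0)) \<and>
          ereal (vol n K\<^sub>0 powr (1 / real n)) * surface_area_perp n \<xi> (proj_perp n \<xi> ` K\<^sub>0)
            \<le> ereal (c / sqrt (real n)) * surface_area n K\<^sub>0)))"
\<comment> \<open>The constant 4 comes from \<open>sqrt n \<le> 8 * r\<close>, which gives
  \<open>1 / (2 * r) \<le> 4 / sqrt n\<close>.\<close>
proof (intro exI[of _ 4] conjI allI impI)
  fix n :: nat assume "n \<ge> 2"
  then obtain k where k: "n = Suc (Suc k)" by (auto simp: le_iff_add numeral_2_eq_2)
  \<comment> \<open>The base has dimension at least 1, so \<open>r ^ (m - 1)\<close> really is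
    \<open>r ^ m / r\<close>.\<close>
  define m where "m = Suc k"
  have n: "n = Suc m" by (simp add: k m_def)
  let ?V = "unit_ball_vol (real m)"
  define r where "r = root n (1 / (2 * ?V))"
  have V0: "?V > 0" by simp
  have r: "r > 0" using V0 n by (simp add: r_def)
  have "r ^ n = 1 / (2 * ?V)" using V0 n by (simp add: r_def del: power_Suc)
  moreover have "2 * r * (?V * r ^ m) = 2 * ?V * r ^ n" by (simp add: n)
  ultimately have vol: "2 * r * (?V * r ^ m) = 1" using V0 by simp
  let ?K = "cylinder m r" and ?\<xi> = "\<lambda>k. if k = m then 1 else 0 :: real"
  have vK: "vol n ?K = 1" using vol_cylinder[OF r] vol by (simp add: n)
  have "sqrt (real n) \<le> 8 * r"
    using dimension_le_of_cylinder_volume[OF r vol] r by (intro real_le_lsqrt) (simp_all add: n)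
  \<comment> \<open>The volume equation says that the base has volume \<open>1 / (2 * r)\<close>,
    which eliminates the volume of the unit ball.\<close>
  have Sr: "?V * (real m * r ^ (m - 1)) = real m / (2 * r\<^sup>2)"
    using vol r by (simp add: m_def field_simps power2_eq_square)
  also have "\<dots> \<le> real n / (2 * r\<^sup>2)"
    by (intro divide_right_mono) (simp_all add: n)
  also have "\<dots> = real n / r * (1 / (2 * r))" by (simp add: power2_eq_square)
  also have "\<dots> \<le> real n / r * (4 / sqrt (real n))"
    using r \<open>sqrt (real n) \<le> 8 * r\<close> n by (intro mult_left_mono) (simp_all add: field_simps)
  finally have "surface_area_perp n ?\<xi> (proj_perp n ?\<xi> ` ?K) \<le> ereal (4 / sqrt (real n)) * surface_area n ?K"
    using surface_area_perp_cylinder_axis[OF r, of m] surface_area_eucl_ball[OF r, of m]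
      surface_area_cylinder[OF r, of m] vK by (simp add: n mult.commute)
  then have "ereal (vol n ?K powr (1 / real n)) * surface_area_perp n ?\<xi> (proj_perp n ?\<xi> ` ?K)
      \<le> ereal (4 / sqrt (real n)) * surface_area n ?K"
    unfolding vK by (simp add: one_ereal_def[symmetric])
  moreover have "\<forall>\<eta>\<in>unit_sphere n. surface_area_perp n ?\<xi> (proj_perp n ?\<xi> ` ?K)
      \<le> surface_area_perp n \<eta> (proj_perp n \<eta> ` ?K)"
    unfolding n surface_area_perp_cylinder_axis[OF r] by (intro ballI surface_area_perp_cylinder_ge[OF r])
  moreover have "?\<xi> \<in> unit_sphere n" unfolding n by (rule unit_vector_in_unit_sphere)
  ultimately show "\<exists>K\<^sub>0. convex_body n K\<^sub>0 \<and> unconditional n K\<^sub>0 \<and> vol n K\<^sub>0 = 1 \<and> minimal_surface_area n K\<^sub>0 \<and>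
        (\<exists>\<xi> \<in> unit_sphere n.
          (\<forall>\<eta> \<in> unit_sphere n.
             surface_area_perp n \<xi> (proj_perp n \<xi> ` K\<^sub>0) \<le> surface_area_perp n \<eta> (proj_perp n \<eta> ` K\<^sub>0)) \<and>
          ereal (vol n K\<^sub>0 powr (1 / real n)) * surface_area_perp n \<xi> (proj_perp n \<xi> ` K\<^sub>0)
            \<le> ereal (4 / sqrt (real n)) * surface_area n K\<^sub>0)"
    using convex_body_cylinder[OF r, of m] unconditional_cylinder[of m r] minimal_surface_area_cylinder[OF r, of m] vK
    unfolding n by blast
qed simp

end
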